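(* Let $n$ be a positive integer, let $N$ be an even integer with $N\geq n-1$, and let $r$ be an integer with $1\leq r\leq n$. Then \[ \sum_{b\in\mathcal{T}_{n}}t^{U_{r}(b)} =\operatorname{Pf}\begin{pmatrix} O_{n}&J_{n}B_{n}^{N}(t)\\ -{}^t\!B_{n}^{N}(t)J_{n}&\bar S_{n+N} \end{pmatrix}. \]
   Context: $\mathcal{T}_n$ denotes the set of triangular shifted arrays $b=(b_{ij})_{1\leq i\leq j\leq n-1}$ of integers whose entries are $\leq n$, weakly decreasing along rows and columns ($b_{ij}\geq b_{i,j+1}$ and $b_{ij}\geq b_{i+1,j}$ whenever both sides are defined), and such that all entries in row $i$ are $\geq n-i$. With the conventions $b_{i,n}=n-i$ for all $i$ and $b_{0,j}=n$ for all $j$, for $r=1,\dots,n$ set $U_{r}(b)=\sum_{s=1}^{n-r}(b_{s,s+r-1}-b_{s,s+r})+\sum_{s=n-r+1}^{n-1}\chi\{b_{s,n-1}>n-s\}$, where $\chi\{P\}$ is $1$ if $P$ holds and $0$ otherwise. $O_n$ is the $n\times n$ zero matrix, $J_n=(\delta_{i,n+1-j})_{1\leq i,j\leq n}$ is the anti-diagonal matrix, and $\bar S_{M}=(\bar s_{ij})_{1\leq i,j\leq M}$ is the skew-symmetric matrix with $\bar s_{ij}=(-1)^{j-i-1}$ for $i<j$. $B_{n}^{N}(t)=(b_{ij}(t))_{0\leq i\leq n-1,\,0\leq j\leq n+N-1}$ is the $n\times(n+N)$ matrix with $b_{0j}(t)=\delta_{0,j}$ and $b_{ij}(t)=\binom{i-1}{j-i}+\binom{i-1}{j-i-1}t$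 for $i\geq1$ (binomial coefficients with negative lower index are $0$). $\operatorname{Pf}$ denotes the Pfaffian of a skew-symmetric matrix of even size. *)

theory Defs
  imports
    "HOL-Combinatorics.Permutations"
    "Jordan_Normal_Form.Matrix"
begin

text \<open>
  Array positions keep the 1-based indexing \<open>1 \<le> i \<le> j \<le> n - 1\<close>.  Matrices are indexed from 0, so
  a matrix given with indices starting at 1 is shifted.
\<close>

definition tri_cells :: "nat \<Rightarrow> (nat \<times> nat) set" where
  "tri_cells n = {(i, j). 1 \<le> i \<and> i \<le> j \<and> j \<le> n - 1}"

text \<open>
  An array is a total function that is 0 outside the triangle, so that distinct functions are
  distinct arrays.
\<close>

definition tri_arrays :: "nat \<Rightarrow> (nat \<Rightarrow> nat \<Rightarrow> int) set" where
  "tri_arrays n = {b.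
     (\<forall>i j. (i, j) \<notin> tri_cells n \<longrightarrow> b i j = 0) \<and>
     (\<forall>(i, j) \<in> tri_cells n. b i j \<le> int n \<and> int n - int i \<le> b i j) \<and>
     (\<forall>i j. (i, j) \<in> tri_cells n \<and> (i, j + 1) \<in> tri_cells n \<longrightarrow> b i j \<ge> b i (j + 1)) \<and>
     (\<forall>i j. (i, j) \<in> tri_cells n \<and> (i + 1, j) \<in> tri_cells n \<longrightarrow> b i j \<ge> b (i + 1) j)}"

text \<open>Entries with the conventions \<open>b\<^sub>0\<^sub>j = n\<close> and \<open>b\<^sub>i\<^sub>n = n - i\<close>.\<close>

definition ext_entry :: "nat \<Rightarrow> (nat \<Rightarrow> nat \<Rightarrow> int) \<Rightarrow> nat \<Rightarrow> nat \<Rightarrow> int" where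
  "ext_entry n b i j =
     (if i = 0 then int n else if j = n then int n - int i else b i j)"

definition U_stat :: "nat \<Rightarrow> nat \<Rightarrow> (nat \<Rightarrow> nat \<Rightarrow> int) \<Rightarrow> int" where
  "U_stat n r b =
     (\<Sum>s = 1..n - r. ext_entry n b s (s + r - 1) - ext_entry n b s (s + r)) +
     (\<Sum>s = n - r + 1..n - 1. of_bool (ext_entry n b s (n - 1) > int n - int s))"

definition binom_int :: "nat \<Rightarrow> int \<Rightarrow> nat" where
  "binom_int m k = (if k < 0 then 0 else m choose nat k)"

definition B_mat :: "nat \<Rightarrow> nat \<Rightarrow> 'a::comm_ring_1 \<Rightarrow> 'a mat" where
  "B_mat n N t = mat n (n + N) (\<lambda>(i, j).
     if i = 0 then of_bool (j = 0)
     else of_nat (binom_int (i - 1) (int j - int i)) +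
          of_nat (binom_int (i - 1) (int j - int i - 1)) * t)"

definition J_mat :: "nat \<Rightarrow> 'a::comm_ring_1 mat" where
  "J_mat n = mat n n (\<lambda>(i, j). of_bool (i + j + 1 = n))"

definition S_bar :: "nat \<Rightarrow> 'a::comm_ring_1 mat" where
  "S_bar M = mat M M (\<lambda>(i, j).
     if i < j then (- 1) ^ (j - i - 1)
     else if j < i then - ((- 1) ^ (i - j - 1))
     else 0)"

text \<open>
  The perfect matchings of \<open>{0..<2*m}\<close>, each encoded by the unique permutation \<open>\<sigma>\<close> that lists its
  blocks as \<open>{\<sigma> 0 < \<sigma> 1}, {\<sigma> 2 < \<sigma> 3}, \<dots>\<close> in increasing order of their least elements.
\<close>

definition matching_perms :: "nat \<Rightarrow> (nat \<Rightarrow> nat) set" where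
  "matching_perms m = {\<sigma>. \<sigma> permutes {0..<2 * m} \<and>
     (\<forall>k<m. \<sigma> (2 * k) < \<sigma> (2 * k + 1)) \<and>
     (\<forall>k. k + 1 < m \<longrightarrow> \<sigma> (2 * k) < \<sigma> (2 * (k + 1)))}"

text \<open>Only meaningful for skew-symmetric matrices of even size.\<close>

definition pfaffian :: "'a::comm_ring_1 mat \<Rightarrow> 'a" where
  "pfaffian A = (let m = dim_row A div 2 in
     \<Sum>\<sigma> \<in> matching_perms m. of_int (sign \<sigma>) * (\<Prod>k<m. A $$ (\<sigma> (2 * k), \<sigma> (2 * k + 1))))"

lemma finite_tri_arrays: "finite (tri_arrays n)"
proof -
  have "tri_arrays n \<subseteq> {b. \<forall>i. (i \<in> {..n} \<longrightarrow> b i \<in> {f. \<forall>j. (j \<in> {..n} \<longrightarrow> f j \<in> {0..int n}) \<and>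
      (j \<notin> {..n} \<longrightarrow> f j = 0)}) \<and> (i \<notin> {..n} \<longrightarrow> b i = (\<lambda>_. 0))}" (is "_ \<subseteq> ?F")
  proof
    fix b assume b: "b \<in> tri_arrays n"
    have out: "b i j = 0" if "(i, j) \<notin> tri_cells n" for i j
      using b that by (auto simp: tri_arrays_def)
    have rng: "b i j \<in> {0..int n}" for i j
    proof (cases "(i, j) \<in> tri_cells n")
      case True
      then have "b i j \<le> int n" "int n - int i \<le> b i j" "i \<le> n"
        using b by (auto simp: tri_arrays_def tri_cells_def)
      then show ?thesis by auto
    qed (simp add: out)
    have "b i j = 0" if "n < i \<or> n < j" for i j
      using that by (intro out) (auto simp: tri_cells_def)
    with rng show "b \<in> ?F" by auto
  qed
  moreover have "finite ?F"
    by (intro finite_set_of_finite_funs) auto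
  ultimately show ?thesis by (rule finite_subset)
qed

text \<open>Hence \<open>nat (U_stat n r b)\<close> is a lossless exponent on \<open>tri_arrays n\<close>.\<close>

lemma U_stat_nonneg:
  assumes "b \<in> tri_arrays n" "1 \<le> r" "r \<le> n"
  shows "0 \<le> U_stat n r b"
proof -
  have "0 \<le> ext_entry n b s (s + r - 1) - ext_entry n b s (s + r)" if s: "s \<in> {1..n - r}" for s
  proof (cases "s + r = n")
    case True
    with s assms have "(s, s + r - 1) \<in> tri_cells n" by (auto simp: tri_cells_def)
    with assms(1) have "int n - int s \<le> b s (s + r - 1)" by (auto simp: tri_arrays_def)
    with True s assms show ?thesis by (auto simp: ext_entry_def)
  next
    case False
    with s assms have "(s, s + r - 1) \<in> tri_cells n" "(s, (s + r - 1) + 1) \<in> tri_cells n"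
      by (auto simp: tri_cells_def)
    with assms(1) have "b s (s + r - 1) \<ge> b s ((s + r - 1) + 1)"
      unfolding tri_arrays_def by blast
    moreover have "(s + r - 1) + 1 = s + r" using assms by simp
    ultimately show ?thesis using False s assms by (auto simp: ext_entry_def)
  qed
  then show ?thesis
    unfolding U_stat_def by (intro add_nonneg_nonneg sum_nonneg) auto
qed

end

theory Submission
  imports Defs
begin

text \<open>
  Reflecting the entries of the \<open>r\<close>-th diagonal in the intervals allowed by their neighbours turns
  \<open>U\<^sub>r\<close> into \<open>U\<^bsub>r-1\<^esub>\<close> (and \<open>U\<^sub>1\<close> into \<open>n - 1 - U\<^sub>1\<close>), so all \<open>U\<^sub>r\<close> have the distribution of
  \<open>\<Sum>\<^sub>s (b\<^bsub>s-1,s\<^esub> - b\<^bsub>s,s\<^esub>)\<close>.  Removing the main diagonal of an array leaves an array of the next smaller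
  size whose main diagonal interlaces with the removed one.

  Expanding the Pfaffian along its first \<open>n\<close> rows gives the minors of \<open>B\<close> times Pfaffians of \<open>S_bar\<close>
  on the unused columns; all signs cancel, so the right-hand side is the sum of the maximal minors
  of \<open>B\<close>.  Multiplying all rows by \<open>1 + t z\<close> is a sequence of elementary column operations, which
  acts on the set of unused columns by the same interlacing relation with weight \<open>t\<close> to the total
  displacement.  As the rows of \<open>B\<^sub>n(t)\<close> are \<open>1\<close> and \<open>z (1 + t z)\<close> times the rows of \<open>B\<^bsub>n-1\<^esub>(1)\<close>, induction
  on \<open>n\<close> identifies the minors with weighted counts of arrays with given main diagonal.
\<close>

section \<open>Expansion of the Pfaffian along the first row\<close>

text \<open>A list of \<open>N\<close> numbers must hold the \<open>n - 1\<close> entries of the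
  main diagonal, which is what \<open>N \<ge> n - 1\<close> provides; the remaining places are
  padding with forced values.

  \<open>S_bar\<close> enters through one property: its entries above the diagonal are
  \<open>- ((-1) ^ (i + j))\<close>, so its Pfaffian on any even set of columns is a single sign.

  Only the outermost step sees \<open>t\<close>, since the rows of the smaller matrix are those for
  \<open>t = 1\<close>. So \<open>t\<close> can only record how the main diagonal differs from its
  neighbour, and the statistic has to be transported there by reflections. A reflection does this
  because the lower end for one cell and the upper end for the next are the maximum and the minimum
  of the same two numbers, whose sum is free of both operations.\<close>

definition matching_sum :: "nat \<Rightarrow> (nat \<Rightarrow> nat \<Rightarrow> 'a::comm_ring_1) \<Rightarrow> 'a" where
  "matching_sum m a =
     (\<Sum>\<sigma> \<in> matching_perms m. of_int (sign \<sigma>) * (\<Prod>k<m. a (\<sigma> (2 * k)) (\<sigma> (2 * k + 1))))"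

lemma pfaffian_eq_matching_sum:
  "pfaffian A = matching_sum (dim_row A div 2) (\<lambda>i j. A $$ (i, j))"
  by (simp add: pfaffian_def matching_sum_def Let_def)

lemma matching_sum_cong:
  assumes "\<And>i j. i < 2 * m \<Longrightarrow> j < 2 * m \<Longrightarrow> i < j \<Longrightarrow> a i j = b i j"
  shows "matching_sum m a = matching_sum m b"
  unfolding matching_sum_def
proof (intro sum.cong refl arg_cong2[where f = "(*)"] prod.cong)
  fix \<sigma> k assume \<sigma>: "\<sigma> \<in> matching_perms m" and k: "k \<in> {..<m}"
  have "\<sigma> permutes {0..<2 * m}" "\<sigma> (2 * k) < \<sigma> (2 * k + 1)"
    using \<sigma> k by (auto simp: matching_perms_def)
  moreover from this have "\<sigma> (2 * k + 1) < 2 * m"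
    using permutes_in_image[of \<sigma> "{0..<2 * m}" "2 * k + 1"] k by auto
  ultimately show "a (\<sigma> (2 * k)) (\<sigma> (2 * k + 1)) = b (\<sigma> (2 * k)) (\<sigma> (2 * k + 1))"
    by (intro assms) auto
qed

text \<open>The cycle that moves 1 to \<open>j + 1\<close> and keeps the order of all other numbers.\<close>

definition move_up :: "nat \<Rightarrow> nat \<Rightarrow> nat" where
  "move_up j x = (if x = 1 then Suc j else if 2 \<le> x \<and> x \<le> Suc j then x - 1 else x)"

lemma move_up_simps [simp]: "move_up j 0 = 0" "move_up j (Suc 0) = Suc j"
  by (auto simp: move_up_def)

lemma move_up_0: "move_up 0 = id"
  by (auto simp: move_up_def fun_eq_iff)

lemma move_up_Suc: "move_up (Suc j) = transpose (Suc j) (Suc (Suc j)) \<circ> move_up j"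
  by (auto simp: move_up_def fun_eq_iff transpose_def)

lemma move_up_permutes: "Suc j < n \<Longrightarrow> move_up j permutes {0..<n}"
proof (induction j)
  case 0
  then show ?case by (simp only: move_up_0 permutes_id)
next
  case (Suc j)
  then show ?case unfolding move_up_Suc
    by (intro permutes_compose permutes_swap_id) auto
qed

lemma sign_move_up: "sign (move_up j) = (- 1) ^ j"
proof (induction j)
  case (Suc j)
  have "permutation (move_up j)"
    using move_up_permutes[of j "Suc (Suc j)"] permutation_permutes by blast
  then show ?case
    unfolding move_up_Suc
    by (subst sign_compose) (simp_all add: Suc permutation_swap_id sign_swap_id)
qed (simp add: move_up_0)

lemma move_up_less_iff: "2 \<le> x \<Longrightarrow> 2 \<le> y \<Longrightarrow> move_up j x < move_up j y \<longleftrightarrow> x < y"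
  by (auto simp: move_up_def)

lemma move_up_pos: "0 < x \<Longrightarrow> 0 < move_up j x"
  by (auto simp: move_up_def)

text \<open>The increasing enumeration of the numbers other than \<open>j\<close>; it relabels the
  indices that are left once \<open>j + 1\<close> is the partner of 0.\<close>

definition skip :: "nat \<Rightarrow> nat \<Rightarrow> nat" where
  "skip j k = (if k < j then k else Suc k)"

lemma move_up_plus2: "move_up j (Suc (Suc x)) = Suc (skip j x)"
  by (auto simp: move_up_def skip_def)

text \<open>Conjugation by the shift keeps the sign, and 0 and 1 become fixed points, the slots of
  the pair that is split off.\<close>

definition lift2 :: "nat \<Rightarrow> (nat \<Rightarrow> nat) \<Rightarrow> nat \<Rightarrow> nat" where
  "lift2 m = map_permutation {0..<2 * m} (\<lambda>x. Suc (Suc x))"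

lemma bij_plus2: "bij_betw (\<lambda>x. Suc (Suc x)) {0..<2 * m} {2..<2 * Suc m}"
  by (rule bij_betwI[where g = "\<lambda>x. x - 2"]) auto

lemma lift2_permutes: "\<tau> permutes {0..<2 * m} \<Longrightarrow> lift2 m \<tau> permutes {2..<2 * Suc m}"
  unfolding lift2_def by (rule map_permutation_permutes[OF bij_plus2])

lemma lift2_apply:
  assumes "\<tau> permutes {0..<2 * m}"
  shows "lift2 m \<tau> 0 = 0" "lift2 m \<tau> (Suc 0) = Suc 0" "lift2 m \<tau> (Suc (Suc x)) = Suc (Suc (\<tau> x))"
proof -
  note p = lift2_permutes[OF assms]
  show "lift2 m \<tau> 0 = 0" "lift2 m \<tau> (Suc 0) = Suc 0"
    using p by (auto intro: permutes_not_in)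
  show "lift2 m \<tau> (Suc (Suc x)) = Suc (Suc (\<tau> x))"
  proof (cases "x < 2 * m")
    case True
    then show ?thesis unfolding lift2_def by (intro map_permutation_apply) (auto simp: inj_on_def)
  next
    case False
    then show ?thesis
      using permutes_not_in[OF p, of "Suc (Suc x)"] permutes_not_in[OF assms, of x] by auto
  qed
qed

text \<open>The block openers increase and each is smaller than its partner, so no value lies below
  \<open>\<sigma> 0\<close>, while the value 0 is attained.\<close>

lemma matching_perms_first:
  assumes "\<sigma> \<in> matching_perms (Suc m)"
  shows "\<sigma> 0 = 0"
proof -
  have p: "\<sigma> permutes {0..<2 * Suc m}"
    and ev: "\<And>k. k < Suc m \<Longrightarrow> \<sigma> (2 * k) < \<sigma> (2 * k + 1)"
    and inc: "\<And>k. k + 1 < Suc m \<Longrightarrow> \<sigma> (2 * k) < \<sigma> (2 * (k + 1))"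
    using assms by (auto simp: matching_perms_def)
  have le: "k < Suc m \<Longrightarrow> \<sigma> 0 \<le> \<sigma> (2 * k)" for k
  proof (induction k)
    case (Suc k)
    then show ?case using inc[of k] by auto
  qed simp
  obtain x where x: "\<sigma> x = 0" "x \<in> {0..<2 * Suc m}"
    using permutes_image[OF p] by (metis (no_types, lifting) atLeastLessThan_iff image_iff
        le0 zero_less_Suc nat_0_less_mult_iff pos2)
  define k where "k = x div 2"
  have k: "k < Suc m" using x by (auto simp: k_def)
  have "x = 2 * k \<or> x = 2 * k + 1" by (auto simp: k_def)
  then show ?thesis using x(1) le[OF k] ev[OF k] by auto
qed

lemma matching_perms_compose_iff:
  assumes \<tau>: "\<tau> permutes {0..<2 * m}" and j: "j \<le> 2 * m"
  shows "move_up j \<circ> lift2 m \<tau> \<in> matching_perms (Suc m) \<longleftrightarrow> \<tau> \<in> matching_perms m"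
proof -
  let ?\<sigma> = "move_up j \<circ> lift2 m \<tau>"
  have "lift2 m \<tau> permutes {0..<2 * Suc m}"
    using lift2_permutes[OF \<tau>] by (rule permutes_subset) auto
  then have perm: "?\<sigma> permutes {0..<2 * Suc m}"
    using j by (intro permutes_compose move_up_permutes) auto
  have c1: "(\<forall>k<Suc m. ?\<sigma> (2 * k) < ?\<sigma> (2 * k + 1)) \<longleftrightarrow> (\<forall>k<m. \<tau> (2 * k) < \<tau> (2 * k + 1))"
    unfolding All_less_Suc2
    by (simp add: lift2_apply[OF \<tau>] move_up_less_iff)
  have c2: "(\<forall>k. k + 1 < Suc m \<longrightarrow> ?\<sigma> (2 * k) < ?\<sigma> (2 * (k + 1))) \<longleftrightarrow>
      (\<forall>k. k + 1 < m \<longrightarrow> \<tau> (2 * k) < \<tau> (2 * (k + 1)))" (is "?L \<longleftrightarrow> ?R")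
  proof
    assume ?L
    show ?R
    proof safe
      fix k assume "k + 1 < m"
      with \<open>?L\<close>[rule_format, of "Suc k"] show "\<tau> (2 * k) < \<tau> (2 * (k + 1))"
        by (simp add: lift2_apply[OF \<tau>] move_up_less_iff)
    qed
  next
    assume R: ?R
    show ?L
    proof safe
      fix k assume k: "k + 1 < Suc m"
      show "?\<sigma> (2 * k) < ?\<sigma> (2 * (k + 1))"
      proof (cases k)
        case 0
        then show ?thesis by (simp add: lift2_apply[OF \<tau>] move_up_pos numeral_2_eq_2)
      next
        case (Suc l)
        then show ?thesis using R[rule_format, of l] k
          by (simp add: lift2_apply[OF \<tau>] move_up_less_iff)
      qed
    qed
  qed
  show ?thesis using perm \<tau> c1 c2 by (simp add: matching_perms_def)
qed

text \<open>The partner \<open>j + 1\<close> of 0 is arbitrary, and the other blocks form a matching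
  after an order-preserving relabelling, which respects the normal form.\<close>

lemma matching_perms_Suc_bij:
  "bij_betw (\<lambda>(j, \<tau>). move_up j \<circ> lift2 m \<tau>) ({..2 * m} \<times> matching_perms m) (matching_perms (Suc m))"
proof -
  have perm: "\<tau> permutes {0..<2 * m}" if "\<tau> \<in> matching_perms m" for \<tau>
    using that by (simp add: matching_perms_def)
  show ?thesis
    unfolding bij_betw_def
  proof (intro conjI equalityI subsetI)
    show "inj_on (\<lambda>(j, \<tau>). move_up j \<circ> lift2 m \<tau>) ({..2 * m} \<times> matching_perms m)"
    proof (rule inj_onI, clarsimp)
      fix i \<rho> j \<tau>
      assume i: "i \<le> 2 * m" and j: "j \<le> 2 * m" and eq: "move_up i \<circ> lift2 m \<rho> = move_up j \<circ> lift2 m \<tau>"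
        and "\<rho> \<in> matching_perms m" "\<tau> \<in> matching_perms m"
      then have p: "\<rho> permutes {0..<2 * m}" "\<tau> permutes {0..<2 * m}" using perm by auto
      from fun_cong[OF eq, of 1] have ij: "i = j" by (simp add: lift2_apply p)
      have "inj (move_up j)"
        using move_up_permutes[of j "Suc (Suc j)"] permutes_inj by blast
      moreover have "move_up j (lift2 m \<rho> x) = move_up j (lift2 m \<tau> x)" for x
        using fun_cong[OF eq, of x] ij by simp
      ultimately have eq': "lift2 m \<rho> x = lift2 m \<tau> x" for x
        by (auto dest: injD)
      have "\<rho> x = \<tau> x" for x
        using eq'[of "Suc (Suc x)"] by (simp add: lift2_apply p)
      with ij show "i = j \<and> \<rho> = \<tau>" by auto
    qed
  next
    fix \<sigma> assume "\<sigma> \<in> (\<lambda>(j, \<tau>). move_up j \<circ> lift2 m \<tau>) ` ({..2 * m} \<times> matching_perms m)"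
    then show "\<sigma> \<in> matching_perms (Suc m)"
      using matching_perms_compose_iff perm by auto
  next
    fix \<sigma> assume \<sigma>: "\<sigma> \<in> matching_perms (Suc m)"
    then have p: "\<sigma> permutes {0..<2 * Suc m}" by (simp add: matching_perms_def)
    have \<sigma>0: "\<sigma> 0 = 0" by (rule matching_perms_first[OF \<sigma>])
    have "\<sigma> 0 < \<sigma> 1" using \<sigma> by (auto simp: matching_perms_def)
    then obtain j where j: "\<sigma> 1 = Suc j" by (metis Suc_pred' \<sigma>0)
    have "\<sigma> 1 \<in> {0..<2 * Suc m}" using permutes_in_image[OF p] by auto
    with j have jm: "j \<le> 2 * m" by auto
    have mp: "move_up j permutes {0..<2 * Suc m}" using jm by (intro move_up_permutes) auto
    \<comment> \<open>Undoing \<open>move_up j\<close> turns the first block into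
      \<open>{0, 1}\<close>, so \<open>q\<close> fixes both points and is a shifted permutation of
      \<open>2 * m\<close> numbers.\<close>
    define q where "q = inv_into UNIV (move_up j) \<circ> \<sigma>"
    have q01: "q 0 = 0" "q 1 = 1"
      unfolding q_def using j by (auto simp: \<sigma>0 permutes_inv_eq[OF mp])
    have "q permutes {0..<2 * Suc m}"
      unfolding q_def by (intro permutes_compose p permutes_inv mp)
    then have q: "q permutes {2..<2 * Suc m}"
    proof (rule permutes_superset)
      show "q x = x" if "x \<in> {0..<2 * Suc m} - {2..<2 * Suc m}" for x
      proof -
        have "x = 0 \<or> x = 1" using that by auto
        with q01 show ?thesis by auto
      qed
    qed
    define \<tau> where "\<tau> = map_permutation {2..<2 * Suc m} (\<lambda>x. x - 2) q"
    have \<tau>: "\<tau> permutes {0..<2 * m}"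
      unfolding \<tau>_def
      by (rule map_permutation_permutes[OF _ q], rule bij_betwI[where g = "\<lambda>x. Suc (Suc x)"]) auto
    have "lift2 m \<tau> = q"
      unfolding \<tau>_def lift2_def
      by (rule map_permutation_compose_inv[OF _ q],
          rule bij_betwI[where g = "\<lambda>x. Suc (Suc x)"]) auto
    then have "move_up j \<circ> lift2 m \<tau> = \<sigma>"
      by (simp add: q_def fun_eq_iff permutes_inverses[OF mp])
    moreover from this have "\<tau> \<in> matching_perms m"
      using matching_perms_compose_iff[OF \<tau> jm] \<sigma> by simp
    ultimately show "\<sigma> \<in> (\<lambda>(j, \<tau>). move_up j \<circ> lift2 m \<tau>) ` ({..2 * m} \<times> matching_perms m)"
      using jm by (intro image_eqI[where x = "(j, \<tau>)"]) auto
  qed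
qed

lemma matching_sum_Suc:
  "matching_sum (Suc m) a =
    (\<Sum>j\<le>2 * m. (- 1) ^ j * a 0 (Suc j) * matching_sum m (\<lambda>x y. a (Suc (skip j x)) (Suc (skip j y))))"
proof -
  have "matching_sum (Suc m) a = (\<Sum>(j, \<tau>) \<in> {..2 * m} \<times> matching_perms m.
      of_int (sign (move_up j \<circ> lift2 m \<tau>)) * (\<Prod>k<Suc m. a ((move_up j \<circ> lift2 m \<tau>) (2 * k))
        ((move_up j \<circ> lift2 m \<tau>) (2 * k + 1))))"
    unfolding matching_sum_def
    by (subst sum.reindex_bij_betw[OF matching_perms_Suc_bij[of m], symmetric])
      (simp add: case_prod_beta)
  also have "\<dots> = (\<Sum>(j, \<tau>) \<in> {..2 * m} \<times> matching_perms m. (- 1) ^ j * a 0 (Suc j) *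
      (of_int (sign \<tau>) * (\<Prod>k<m. a (Suc (skip j (\<tau> (2 * k)))) (Suc (skip j (\<tau> (2 * k + 1)))))))"
  proof (intro sum.cong refl, clarify)
    fix j \<tau> assume "j \<le> 2 * m" "\<tau> \<in> matching_perms m"
    then have \<tau>: "\<tau> permutes {0..<2 * m}" by (simp add: matching_perms_def)
    have "permutation (move_up j)"
      using move_up_permutes[of j "Suc (Suc j)"] permutation_permutes by blast
    moreover have "permutation (lift2 m \<tau>)"
      using lift2_permutes[OF \<tau>] permutation_permutes by blast
    moreover have "sign (lift2 m \<tau>) = sign \<tau>"
      unfolding lift2_def using \<tau> by (intro sign_map_permutation) (auto simp: inj_on_def)
    ultimately have "sign (move_up j \<circ> lift2 m \<tau>) = (- 1) ^ j * sign \<tau>"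
      by (simp add: sign_compose sign_move_up)
    then show "of_int (sign (move_up j \<circ> lift2 m \<tau>)) * (\<Prod>k<Suc m. a ((move_up j \<circ> lift2 m \<tau>) (2 * k))
        ((move_up j \<circ> lift2 m \<tau>) (2 * k + 1))) = (- 1) ^ j * a 0 (Suc j) *
      (of_int (sign \<tau>) * (\<Prod>k<m. a (Suc (skip j (\<tau> (2 * k)))) (Suc (skip j (\<tau> (2 * k + 1))))))"
      by (subst prod.lessThan_Suc_shift)
        (simp add: lift2_apply[OF \<tau>] move_up_plus2 mult_ac)
  qed
  also have "\<dots> = (\<Sum>j\<le>2 * m. (- 1) ^ j * a 0 (Suc j) *
      matching_sum m (\<lambda>x y. a (Suc (skip j x)) (Suc (skip j y))))"
    by (simp add: matching_sum_def sum.cartesian_product sum_distrib_left)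
  finally show ?thesis .
qed

text \<open>The Pfaffian of the principal submatrix on \<open>U\<close>. Indexing by sets avoids
  nested relabellings by \<open>skip\<close> in iterated expansions.\<close>

definition pf_set :: "(nat \<Rightarrow> nat \<Rightarrow> 'a::comm_ring_1) \<Rightarrow> nat set \<Rightarrow> 'a" where
  "pf_set a U = matching_sum (card U div 2) (\<lambda>i j. a (sorted_list_of_set U ! i) (sorted_list_of_set U ! j))"

lemma pf_set_lessThan: "pf_set a {..<2 * m} = matching_sum m a"
proof -
  have "sorted_list_of_set {..<2 * m} = [0..<2 * m]" by (simp add: lessThan_atLeast0)
  then show ?thesis unfolding pf_set_def by (auto intro!: matching_sum_cong)
qed

lemma matching_perms_0: "matching_perms 0 = {id}"
  by (auto simp: matching_perms_def)

lemma pf_set_empty: "pf_set a {} = 1"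
  by (simp add: pf_set_def matching_sum_def matching_perms_0)

lemma card_less_nth:
  assumes "finite (U :: nat set)" "j < card U"
  shows "card {v \<in> U. v < sorted_list_of_set U ! j} = j"
proof -
  let ?xs = "sorted_list_of_set U"
  have "{v \<in> U. v < ?xs ! j} = (!) ?xs ` {..<j}"
  proof (intro equalityI subsetI)
    fix v assume "v \<in> {v \<in> U. v < ?xs ! j}"
    then have "v \<in> set ?xs" "v < ?xs ! j" using assms(1) by auto
    then obtain i where "i < card U" "v = ?xs ! i" "?xs ! i < ?xs ! j"
      by (auto simp: in_set_conv_nth)
    moreover from this have "i < j"
      by (metis assms(2) linorder_not_less sorted_list_of_set.sorted_sorted_key_list_of_set
          sorted_nth_mono sorted_list_of_set.length_sorted_key_list_of_set)
    ultimately show "v \<in> (!) ?xs ` {..<j}" by auto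
  next
    fix v assume "v \<in> (!) ?xs ` {..<j}"
    then obtain i where "i < j" "v = ?xs ! i" by auto
    moreover from this have "?xs ! i < ?xs ! j"
      using strict_sorted_list_of_set[of U] assms by (auto simp: sorted_wrt_iff_nth_less)
    moreover have "?xs ! i \<in> U"
      using \<open>i < j\<close> assms by (metis length_sorted_list_of_set nth_mem order_less_trans set_sorted_list_of_set)
    ultimately show "v \<in> {v \<in> U. v < ?xs ! j}" by auto
  qed
  moreover have "inj_on ((!) ?xs) {..<j}"
    using assms by (intro inj_on_nth) auto
  ultimately show ?thesis by (simp add: card_image)
qed

lemma bij_betw_sorted_list_of_set:
  assumes "finite (U :: nat set)"
  shows "bij_betw ((!) (sorted_list_of_set U)) {..<card U} U"
  using assms by (intro bij_betw_nth) auto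

lemma nth_sorted_list_of_set_Diff:
  assumes "finite (U :: nat set)" "j < card U" "k < card U - 1"
  shows "sorted_list_of_set (U - {sorted_list_of_set U ! j}) ! k = sorted_list_of_set U ! skip j k"
proof -
  let ?xs = "sorted_list_of_set U"
  let ?ys = "take j ?xs @ drop (Suc j) ?xs"
  have xs: "?xs = take j ?xs @ ?xs ! j # drop (Suc j) ?xs"
    using assms by (intro id_take_nth_drop) auto
  have ss: "sorted_wrt (<) (take j ?xs @ ?xs ! j # drop (Suc j) ?xs)"
    using strict_sorted_list_of_set[of U] xs by metis
  then have "sorted_wrt (<) ?ys"
    by (auto simp: sorted_wrt_append)
  moreover have "set ?ys = U - {?xs ! j}"
  proof -
    have "U = set (take j ?xs @ ?xs ! j # drop (Suc j) ?xs)"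
      using xs assms(1) by (metis set_sorted_list_of_set)
    moreover have "?xs ! j \<notin> set ?ys" using ss by (auto simp: sorted_wrt_append)
    ultimately show ?thesis by auto
  qed
  ultimately have "sorted_list_of_set (U - {?xs ! j}) = ?ys"
    using strict_sorted_list_of_set assms(1) by (intro strict_sorted_equal) auto
  then show ?thesis
    using assms by (auto simp: nth_append skip_def)
qed

lemma pf_set_expand:
  assumes "finite U" "odd (card U)" "\<forall>u\<in>U. x < u"
  shows "pf_set a (insert x U) = (\<Sum>u\<in>U. (- 1) ^ card {v \<in> U. v < u} * a x u * pf_set a (U - {u}))"
proof -
  let ?xs = "sorted_list_of_set U"
  obtain m where m: "card U = Suc (2 * m)" using assms(2) by (metis oddE Suc_eq_plus1)
  have xU: "x \<notin> U" using assms(3) by auto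
  have list: "sorted_list_of_set (insert x U) = x # ?xs"
  proof (rule strict_sorted_equal)
    show "sorted_wrt (<) (x # ?xs)"
      using assms(1,3) by simp
    show "set (sorted_list_of_set (insert x U)) = set (x # ?xs)"
      using assms(1) by (simp only: set_sorted_list_of_set finite_insert list.set)
  qed (rule strict_sorted_list_of_set)
  have card: "card (insert x U) div 2 = Suc m" using assms(1) xU m by simp
  have "pf_set a (insert x U) = (\<Sum>j\<le>2 * m. (- 1) ^ j * a x (?xs ! j) *
      matching_sum m (\<lambda>i k. a (?xs ! skip j i) (?xs ! skip j k)))"
    unfolding pf_set_def card list matching_sum_Suc by simp
  also have "\<dots> = (\<Sum>j<card U. (- 1) ^ card {v \<in> U. v < ?xs ! j} * a x (?xs ! j) * pf_set a (U - {?xs ! j}))"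
  proof (rule sum.cong)
    fix j assume "j \<in> {..<card U}"
    then have j: "j < card U" by simp
    then have mem: "?xs ! j \<in> U"
      using assms(1) by (metis length_sorted_list_of_set nth_mem set_sorted_list_of_set)
    have "pf_set a (U - {?xs ! j}) = matching_sum m (\<lambda>i k. a (?xs ! skip j i) (?xs ! skip j k))"
      unfolding pf_set_def using m mem assms(1) j
      by (auto intro!: matching_sum_cong simp: nth_sorted_list_of_set_Diff)
    then show "(- 1) ^ j * a x (?xs ! j) * matching_sum m (\<lambda>i k. a (?xs ! skip j i) (?xs ! skip j k)) =
        (- 1) ^ card {v \<in> U. v < ?xs ! j} * a x (?xs ! j) * pf_set a (U - {?xs ! j})"
      using card_less_nth[OF assms(1) j] by simp
  qed (auto simp: m)
  also have "\<dots> = (\<Sum>u\<in>U. (- 1) ^ card {v \<in> U. v < u} * a x u * pf_set a (U - {u}))"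
    by (rule sum.reindex_bij_betw[OF bij_betw_sorted_list_of_set[OF assms(1)]])
  finally show ?thesis .
qed

section \<open>Sub-Pfaffians of the alternating sign pattern\<close>

lemma sum_alternating_card_less:
  assumes "finite (U :: nat set)" "odd (card U)"
  shows "(\<Sum>u\<in>U. (- 1) ^ card {v \<in> U. v < u}) = (1 :: 'a::comm_ring_1)"
proof -
  have "(\<Sum>u\<in>U. (- 1) ^ card {v \<in> U. v < u}) = (\<Sum>j<card U. (- 1) ^ j :: 'a)"
    by (subst sum.reindex_bij_betw[OF bij_betw_sorted_list_of_set[OF assms(1)], symmetric])
      (auto intro!: sum.cong simp: card_less_nth[OF assms(1)])
  moreover have "(\<Sum>j<n. (- 1) ^ j) = (of_bool (odd n) :: 'a)" for n
    by (induction n) auto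
  ultimately show ?thesis using assms(2) by simp
qed

text \<open>An entry is \<open>-1\<close> times a sign depending on \<open>i\<close> times a sign
  depending on \<open>j\<close>, so all matchings have the same weight. Their signs add up to 1: in
  the expansion along the least index an odd number of alternating signs remains.\<close>

lemma pf_set_alternating:
  assumes "finite U" "even (card U)" "\<And>i j. i < j \<Longrightarrow> i \<in> U \<Longrightarrow> j \<in> U \<Longrightarrow> a i j = - ((- 1) ^ (i + j))"
  shows "pf_set a U = (- 1) ^ (\<Sum>U + card U div 2)"
  using assms
proof (induction "card U" arbitrary: U rule: less_induct)
  case less
  show ?case
  proof (cases "U = {}")
    case True
    then show ?thesis by (simp add: pf_set_empty)
  next
    case False
    define x V where "x = Min U" and "V = U - {x}"
    have x: "x \<in> U" unfolding x_def by (rule Min_in[OF less.prems(1) False])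
    then have U: "U = insert x V" "x \<notin> V" "finite V" using less.prems(1) by (auto simp: V_def)
    have lt: "\<forall>u\<in>V. x < u"
    proof
      fix u assume "u \<in> V"
      then have "u \<in> U" "u \<noteq> x" by (auto simp: V_def)
      then show "x < u" using Min_le[OF less.prems(1)] by (simp add: x_def order.strict_iff_order)
    qed
    have cU: "card U = Suc (card V)" using U by simp
    have odd: "odd (card V)" using less.prems(2) cU by simp
    have "pf_set a U = (\<Sum>u\<in>V. (- 1) ^ card {v \<in> V. v < u} * a x u * pf_set a (V - {u}))"
      unfolding U(1) by (rule pf_set_expand[OF U(3) odd lt])
    also have "\<dots> = (\<Sum>u\<in>V. (- 1) ^ card {v \<in> V. v < u} * (- 1) ^ (\<Sum>U + card U div 2))"
    proof (rule sum.cong[OF refl])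
      fix u assume u: "u \<in> V"
      have cV: "card V = Suc (card (V - {u}))" using u U(3) by (metis card.remove)
      have ev: "even (card (V - {u}))" using odd unfolding cV by (simp only: even_Suc not_not)
      have "pf_set a (V - {u}) = (- 1) ^ (\<Sum>(V - {u}) + card (V - {u}) div 2)"
      proof (rule less.hyps)
        show "card (V - {u}) < card U" using cU cV by linarith
        show "a i j = - ((- 1) ^ (i + j))" if "i < j" "i \<in> V - {u}" "j \<in> V - {u}" for i j
          using that U(1) by (intro less.prems(3)) auto
      qed (use U(3) ev in simp_all)
      moreover have "a x u = - ((- 1) ^ (x + u))"
        using u lt U(1) by (intro less.prems(3)) auto
      moreover have "\<Sum>U = x + u + \<Sum>(V - {u})"
        unfolding U(1) sum.insert[OF U(3,2)] sum.remove[OF U(3) u] by (simp only: add.assoc)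
      moreover have "card U div 2 = Suc (card (V - {u}) div 2)" using cU cV by linarith
      ultimately show "(- 1) ^ card {v \<in> V. v < u} * a x u * pf_set a (V - {u}) =
          (- 1) ^ card {v \<in> V. v < u} * (- 1) ^ (\<Sum>U + card U div 2)"
        by (simp only: power_add power_Suc mult_minus_left mult_minus_right mult_1 mult.assoc)
    qed
    also have "\<dots> = (- 1) ^ (\<Sum>U + card U div 2)"
      by (simp only: sum_distrib_right[symmetric] sum_alternating_card_less[OF U(3) odd] mult_1)
    finally show ?thesis .
  qed
qed

section \<open>Minors and column operations\<close>

text \<open>
  The determinant of the columns \<open>J\<close> with its rows listed from last to first, so that the sign of an
  entry of the first listed row counts the columns to its right.
\<close>

primrec minor :: "(nat \<Rightarrow> 'a::comm_ring_1) list \<Rightarrow> nat set \<Rightarrow> 'a" where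
  "minor [] J = of_bool (J = {})"
| "minor (f # fs) J = (\<Sum>j\<in>J. (- 1) ^ card {i \<in> J. j < i} * f j * minor fs (J - {j}))"

lemma minor_cong:
  assumes "\<And>i j. i \<in> set is \<Longrightarrow> j \<in> J \<Longrightarrow> F i j = G i j"
  shows "minor (map F is) J = minor (map G is) J"
  using assms
proof (induction "is" arbitrary: J)
  case (Cons i "is")
  have "minor (map F is) (J - {j}) = minor (map G is) (J - {j})" for j
    using Cons.prems by (intro Cons.IH) auto
  then show ?case using Cons.prems by simp
qed simp

definition add_column :: "'a::comm_ring_1 \<Rightarrow> nat \<Rightarrow> (nat \<Rightarrow> 'a) \<Rightarrow> nat \<Rightarrow> 'a" where
  "add_column t p f = f(Suc p := f (Suc p) + t * f p)"

lemma add_column_apply: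
  "add_column t p f (Suc p) = f (Suc p) + t * f p"
  "j \<noteq> Suc p \<Longrightarrow> add_column t p f j = f j"
  by (auto simp: add_column_def)

text \<open>Multilinearity in column \<open>p + 1\<close>. The extra term has column
  \<open>p\<close> in its place: it vanishes if \<open>p\<close> is already used, and otherwise
  needs no sign because the two columns are adjacent.\<close>

lemma minor_add_column:
  assumes "finite J"
  shows "minor (map (add_column t p) fs) J =
    minor fs J + (if Suc p \<in> J \<and> p \<notin> J then t * minor fs (insert p (J - {Suc p})) else 0)"
  using assms
proof (induction fs arbitrary: J)
  case Nil
  then show ?case by auto
next
  case (Cons f fs)
  let ?f = "add_column t p f"
  let ?fs = "map (add_column t p) fs"
  let ?s = "\<lambda>J j. (- 1 :: 'a) ^ card {i \<in> J. j < i}"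
  have fin: "finite (J - {j})" for j using Cons.prems by simp
  note IH = Cons.IH[OF fin]
  show ?case
  proof (cases "Suc p \<in> J")
    case False
    then have "j \<in> J \<Longrightarrow> ?f j * minor ?fs (J - {j}) = f j * minor fs (J - {j})" for j
      by (cases "j = Suc p") (simp_all add: IH add_column_apply)
    with False show ?thesis by (simp add: mult.assoc)
  next
    case S: True
    define K where "K = J - {p, Suc p}"
    have K: "finite K" "p \<notin> K" "Suc p \<notin> K" using Cons.prems by (auto simp: K_def)
    show ?thesis
    proof (cases "p \<in> J")
      case True
      have J: "J = insert p (insert (Suc p) K)" using S True by (auto simp: K_def)
      have J1: "J - {Suc p} = insert p K" "J - {p} = insert (Suc p) K" using K by (auto simp: J)
      have "{i \<in> J. p < i} = insert (Suc p) {i \<in> J. Suc p < i}"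
        using S by auto
      \<comment> \<open>The opposite signs cancel the two terms with factor \<open>t * f p\<close>,
        one from the changed entry of \<open>f\<close> and one from the induction
        hypothesis.\<close>
      then have sign: "?s J p = - ?s J (Suc p)" using Cons.prems by simp
      have split: "(\<Sum>j\<in>J. g j) = g p + g (Suc p) + (\<Sum>j\<in>K. g j)" for g :: "nat \<Rightarrow> 'a"
        unfolding J using K by simp
      have rest: "minor ?fs (J - {j}) = minor fs (J - {j})" if "j \<in> K" for j
      proof -
        have "p \<in> J - {j}" using that True K by auto
        then show ?thesis by (simp add: IH)
      qed
      have eqs: "minor ?fs (insert (Suc p) K) = minor fs (insert (Suc p) K) + t * minor fs (insert p K)"
        "minor ?fs (insert p K) = minor fs (insert p K)"
        using IH[of p] IH[of "Suc p"] K by (auto simp: J1)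
      have "(\<Sum>j\<in>K. ?s J j * ?f j * minor ?fs (J - {j})) = (\<Sum>j\<in>K. ?s J j * f j * minor fs (J - {j}))"
        using rest K by (intro sum.cong) (auto simp: add_column_def)
      then show ?thesis
        using True by (simp add: split J1 eqs sign add_column_apply algebra_simps)
    next
      case False
      have J: "J = insert (Suc p) K" using S False by (auto simp: K_def)
      define J' where "J' = insert p K"
      have J': "insert p (J - {Suc p}) = J'" using K by (auto simp: J J'_def)
      \<comment> \<open>Nothing lies strictly between \<open>p\<close> and \<open>p + 1\<close>, so
        the exchange crosses no other column.\<close>
      have sign: "?s J' j = ?s J j" if "j \<in> K" for j
      proof (cases "j < p")
        case True
        then have "{i \<in> J'. j < i} = insert p {i \<in> K. j < i}" "{i \<in> J. j < i} = insert (Suc p) {i \<in> K. j < i}"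
          by (auto simp: J J'_def)
        then show ?thesis using K by simp
      next
        case False
        then have "{i \<in> J'. j < i} = {i \<in> K. j < i}" "{i \<in> J. j < i} = {i \<in> K. j < i}"
          using K that by (auto simp: J J'_def less_Suc_eq)
        then show ?thesis by simp
      qed
      have sign_p: "?s J' p = ?s J (Suc p)"
      proof -
        have "{i \<in> J'. p < i} = {i \<in> J. Suc p < i}"
          using K by (auto simp: J J'_def) (metis Suc_lessI)
        then show ?thesis by simp
      qed
      have sJ: "(\<Sum>j\<in>J. g j) = g (Suc p) + (\<Sum>j\<in>K. g j)" for g :: "nat \<Rightarrow> 'a"
        unfolding J using K by simp
      have sJ': "(\<Sum>j\<in>J'. g j) = g p + (\<Sum>j\<in>K. g j)" for g :: "nat \<Rightarrow> 'a"
        unfolding J'_def using K by simp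
      have JK: "J - {Suc p} = K" "J' - {p} = K" using K by (auto simp: J J'_def)
      have eq_p: "minor ?fs K = minor fs K"
        using IH[of "Suc p"] K by (simp add: JK)
      have rest: "minor ?fs (J - {j}) = minor fs (J - {j}) + t * minor fs (J' - {j})" if "j \<in> K" for j
      proof -
        have "j \<noteq> p" "j \<noteq> Suc p" using that K by auto
        then have "insert p (J - {j} - {Suc p}) = J' - {j}" "Suc p \<in> J - {j}" "p \<notin> J - {j}"
          using S False by (auto simp: K_def J'_def)
        then show ?thesis by (simp add: IH)
      qed
      have "(\<Sum>j\<in>K. ?s J j * ?f j * minor ?fs (J - {j})) =
          (\<Sum>j\<in>K. ?s J j * f j * minor fs (J - {j})) + t * (\<Sum>j\<in>K. ?s J' j * f j * minor fs (J' - {j}))"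
        unfolding sum_distrib_left sum.distrib[symmetric]
        using K by (intro sum.cong refl) (auto simp: rest sign add_column_def algebra_simps)
      then show ?thesis
        using S False
        by (simp add: J'_def[symmetric] sJ sJ' JK eq_p sign_p add_column_apply algebra_simps)
    qed
  qed
qed

text \<open>
  The coefficients of \<open>(1 + t z) f\<close> above position \<open>q\<close> and of \<open>f\<close> elsewhere.  Lowering \<open>q\<close> by one is a
  single elementary column operation.
\<close>

definition mult_linear_above :: "'a::comm_ring_1 \<Rightarrow> nat \<Rightarrow> (nat \<Rightarrow> 'a) \<Rightarrow> nat \<Rightarrow> 'a" where
  "mult_linear_above t q f j = (if q < j then f j + t * f (j - 1) else f j)"

text \<open>Only columns above \<open>q + 1\<close> have been changed so far, so the source column
  \<open>q\<close> still holds the coefficients of \<open>f\<close>.\<close>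

lemma mult_linear_above_Suc:
  "mult_linear_above t q f = add_column t q (mult_linear_above t (Suc q) f)"
  by (auto simp: add_column_def mult_linear_above_def fun_eq_iff)

section \<open>Interlacing lists and multiplication of all rows by a linear factor\<close>

fun interlacing :: "nat \<Rightarrow> nat list \<Rightarrow> nat list set" where
  "interlacing L [] = {[]}"
| "interlacing L (c # cs) = (\<lambda>(e, es). e # es) ` ({c..<hd (cs @ [L])} \<times> interlacing L cs)"

lemma in_interlacing_iff:
  "es \<in> interlacing L cs \<longleftrightarrow>
     length es = length cs \<and> (\<forall>i<length cs. cs ! i \<le> es ! i \<and> es ! i < (cs @ [L]) ! Suc i)"
proof (induction cs arbitrary: es)
  case (Cons c cs)
  have hd: "hd (cs @ [L]) = (cs @ [L]) ! 0" by (cases cs) auto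
  show ?case
  proof (cases es)
    case (Cons e es')
    have "es \<in> interlacing L (c # cs) \<longleftrightarrow> c \<le> e \<and> e < (cs @ [L]) ! 0 \<and> es' \<in> interlacing L cs"
      unfolding Cons by (auto simp: hd image_iff)
    then show ?thesis
      unfolding Cons.IH Cons by (auto simp: All_less_Suc2)
  qed auto
qed auto

lemma sum_interlacing_Cons:
  "(\<Sum>es\<in>interlacing L (c # cs). f es) = (\<Sum>e = c..<hd (cs @ [L]). \<Sum>es\<in>interlacing L cs. f (e # es))"
proof -
  have "inj_on (\<lambda>(e, es). e # es) ({c..<hd (cs @ [L])} \<times> interlacing L cs)"
    by (auto simp: inj_on_def)
  then show ?thesis
    unfolding interlacing.simps by (subst sum.reindex) (auto simp: sum.cartesian_product case_prod_beta)
qed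

lemma sum_list_interlacing_le: "es \<in> interlacing L cs \<Longrightarrow> sum_list cs \<le> sum_list es"
  by (induction cs arbitrary: es) (force simp: add_mono)+

lemma interlacing_bounds:
  assumes "es \<in> interlacing L cs" "sorted_wrt (<) cs" "set cs \<subseteq> {..<L}"
  shows "sorted_wrt (<) es" "set es \<subseteq> {..<L}" "cs \<noteq> [] \<Longrightarrow> set es \<subseteq> {hd cs..}"
proof -
  have "sorted_wrt (<) es \<and> set es \<subseteq> {..<L} \<and> (cs \<noteq> [] \<longrightarrow> set es \<subseteq> {hd cs..})"
    using assms
  proof (induction cs arbitrary: es)
    case (Cons c cs)
    then obtain e es' where es: "es = e # es'" "c \<le> e" "e < hd (cs @ [L])" "es' \<in> interlacing L cs"
      by auto
    have IH: "sorted_wrt (<) es' \<and> set es' \<subseteq> {..<L} \<and> (cs \<noteq> [] \<longrightarrow> set es' \<subseteq> {hd cs..})"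
      using Cons.prems es by (intro Cons.IH) auto
    show ?case
    proof (cases cs)
      case Nil
      then show ?thesis using es by auto
    next
      case (Cons d ds)
      then show ?thesis using es IH Cons.prems by fastforce
    qed
  qed simp
  then show "sorted_wrt (<) es" "set es \<subseteq> {..<L}" "cs \<noteq> [] \<Longrightarrow> set es \<subseteq> {hd cs..}" by auto
qed

context
  fixes t :: "'a::comm_ring_1" and fs :: "(nat \<Rightarrow> 'a) list" and L :: nat
begin

private definition hybrid :: "nat \<Rightarrow> nat set \<Rightarrow> 'a" where
  "hybrid q C = minor (map (mult_linear_above t q) fs) ({..<L} - C)"

private lemma hybrid_step:
  assumes "Suc q < L"
  shows "hybrid q C = hybrid (Suc q) C + (if Suc q \<notin> C \<and> q \<in> C then t * hybrid (Suc q) (insert (Suc q) (C - {q})) else 0)"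
proof -
  have "map (mult_linear_above t q) fs = map (add_column t q) (map (mult_linear_above t (Suc q)) fs)"
    by (simp add: mult_linear_above_Suc[of t q])
  moreover have "insert q ({..<L} - C - {Suc q}) = {..<L} - insert (Suc q) (C - {q})" if "q \<in> C"
    using assms that by auto
  ultimately show ?thesis
    unfolding hybrid_def using assms by (simp only: minor_add_column finite_Diff finite_lessThan) auto
qed

text \<open>
  In terms of the omitted columns \<open>C\<close>, lowering \<open>q\<close> lets an element \<open>q\<close> of \<open>C\<close> jump to \<open>q + 1\<close> if that
  place is free.  As the low positions are treated last, each element moves up by any distance
  below its original successor.
\<close>

private lemma hybrid_skip:
  assumes "q \<le> r" "r < L" "\<And>x. q \<le> x \<Longrightarrow> x < r \<Longrightarrow> x \<notin> C \<or> Suc x \<in> C"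
  shows "hybrid q C = hybrid r C"
  using assms
proof (induction r)
  case (Suc r)
  show ?case
  proof (cases "q = Suc r")
    case False
    then have "hybrid q C = hybrid r C" using Suc.prems by (intro Suc.IH) auto
    also have "\<dots> = hybrid (Suc r) C" using Suc.prems(3)[of r] Suc.prems(1,2) False by (subst hybrid_step) auto
    finally show ?thesis .
  qed simp
qed simp

text \<open>The element at \<open>c\<close> either stays, and the free places up to
  \<open>d - 1\<close> have no further effect, or it moves to \<open>c + 1\<close> with a factor
  \<open>t\<close> and faces the same choice there.\<close>

private lemma hybrid_block:
  assumes "c < d" "d \<le> L" "c \<in> C" "\<And>x. c < x \<Longrightarrow> x < d \<Longrightarrow> x \<notin> C"
  shows "hybrid c C = (\<Sum>e = c..<d. t ^ (e - c) * hybrid (d - 1) (insert e (C - {c})))"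
  using assms
proof (induction "d - c" arbitrary: c C)
  case (Suc k)
  show ?case
  proof (cases "d = Suc c")
    case True
    then show ?thesis using Suc.prems by (simp add: insert_absorb)
  next
    case False
    let ?C = "insert (Suc c) (C - {c})"
    have "hybrid c C = hybrid (Suc c) C + t * hybrid (Suc c) ?C"
      using Suc.prems False by (subst hybrid_step) auto
    also have "hybrid (Suc c) C = hybrid (d - 1) C"
      using Suc.prems False by (intro hybrid_skip) auto
    also have "hybrid (Suc c) ?C = (\<Sum>e = Suc c..<d. t ^ (e - Suc c) * hybrid (d - 1) (insert e (?C - {Suc c})))"
      using Suc.prems Suc.hyps(2) False by (intro Suc.hyps(1)) auto
    also have "?C - {Suc c} = C - {c}"
      using Suc.prems(4)[of "Suc c"] Suc.prems(1) False by auto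
    also have "t * (\<Sum>e = Suc c..<d. t ^ (e - Suc c) * hybrid (d - 1) (insert e (C - {c}))) =
        (\<Sum>e = Suc c..<d. t ^ (e - c) * hybrid (d - 1) (insert e (C - {c})))"
      unfolding sum_distrib_left
      by (intro sum.cong refl) (auto simp: Suc_diff_le Suc_diff_Suc simp flip: mult.assoc power_Suc)
    also have "hybrid (d - 1) C + \<dots> = (\<Sum>e = c..<d. t ^ (e - c) * hybrid (d - 1) (insert e (C - {c})))"
      using Suc.prems by (subst (2) sum.atLeast_Suc_lessThan) (auto simp: insert_absorb)
    finally show ?thesis .
  qed
qed simp

text \<open>\<open>A\<close> collects the elements already placed. They lie below \<open>c\<close>,
  out of reach of the operations that remain to be expanded.\<close>

private lemma hybrid_interlacing:
  assumes "sorted_wrt (<) (c # cs)" "set (c # cs) \<subseteq> {..<L}" "\<forall>a\<in>A. a < c"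
  shows "hybrid c (A \<union> set (c # cs)) =
    (\<Sum>es\<in>interlacing L (c # cs). t ^ (sum_list es - sum_list (c # cs)) * hybrid (L - 1) (A \<union> set es))"
  using assms
proof (induction cs arbitrary: c A)
  case Nil
  have "hybrid c (A \<union> {c}) = (\<Sum>e = c..<L. t ^ (e - c) * hybrid (L - 1) (insert e (A \<union> {c} - {c})))"
    using Nil by (intro hybrid_block) force+
  also have "A \<union> {c} - {c} = A" using Nil by auto
  finally show ?case by (subst sum_interlacing_Cons) simp
next
  case (Cons d ds)
  have "hybrid c (A \<union> set (c # d # ds)) =
      (\<Sum>e = c..<d. t ^ (e - c) * hybrid (d - 1) (insert e (A \<union> set (c # d # ds) - {c})))"
    using Cons.prems by (intro hybrid_block) force+
  also have "A \<union> set (c # d # ds) - {c} = A \<union> set (d # ds)"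
    using Cons.prems by auto
  also have "(\<Sum>e = c..<d. t ^ (e - c) * hybrid (d - 1) (insert e (A \<union> set (d # ds)))) =
      (\<Sum>e = c..<d. t ^ (e - c) * (\<Sum>es\<in>interlacing L (d # ds).
         t ^ (sum_list es - sum_list (d # ds)) * hybrid (L - 1) (A \<union> set (e # es))))"
  proof (intro sum.cong refl arg_cong2[where f = "(*)"])
    fix e assume e: "e \<in> {c..<d}"
    \<comment> \<open>The move from \<open>d - 1\<close> to \<open>d\<close> is blocked because
      \<open>d\<close> is occupied.\<close>
    have "hybrid (d - 1) (insert e (A \<union> set (d # ds))) = hybrid d (insert e A \<union> set (d # ds))"
      using Cons.prems e by (subst hybrid_skip[of _ d]) (auto simp: insert_commute)
    also have "\<dots> = (\<Sum>es\<in>interlacing L (d # ds).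
        t ^ (sum_list es - sum_list (d # ds)) * hybrid (L - 1) (insert e A \<union> set es))"
      using Cons.prems e by (intro Cons.IH) auto
    finally show "hybrid (d - 1) (insert e (A \<union> set (d # ds))) = (\<Sum>es\<in>interlacing L (d # ds).
        t ^ (sum_list es - sum_list (d # ds)) * hybrid (L - 1) (A \<union> set (e # es)))" by simp
  qed
  also have "\<dots> = (\<Sum>es\<in>interlacing L (c # d # ds).
      t ^ (sum_list es - sum_list (c # d # ds)) * hybrid (L - 1) (A \<union> set es))"
    unfolding sum_interlacing_Cons[of _ _ c] sum_distrib_left
  proof (intro sum.cong refl, simp only: append_Cons list.sel)
    fix e es assume "e \<in> {c..<hd ((d # ds) @ [L])}" "es \<in> interlacing L (d # ds)"
    moreover from this(2) have "sum_list (d # ds) \<le> sum_list es" by (rule sum_list_interlacing_le)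
    ultimately have "sum_list (e # es) - sum_list (c # d # ds) = (e - c) + (sum_list es - sum_list (d # ds))"
      by simp
    then show "t ^ (e - c) * (t ^ (sum_list es - sum_list (d # ds)) * hybrid (L - 1) (A \<union> set (e # es))) =
        t ^ (sum_list (e # es) - sum_list (c # d # ds)) * hybrid (L - 1) (A \<union> set (e # es))"
      by (simp only: power_add mult.assoc)
  qed
  finally show ?case .
qed

lemma minor_mult_linear:
  assumes "sorted_wrt (<) cs" "set cs \<subseteq> {..<L}"
  shows "minor (map (mult_linear_above t 0) fs) ({..<L} - set cs) =
    (\<Sum>es\<in>interlacing L cs. t ^ (sum_list es - sum_list cs) * minor fs ({..<L} - set es))"
proof -
  \<comment> \<open>At \<open>L - 1\<close> only columns outside \<open>{..<L}\<close> would be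
    altered.\<close>
  have last: "hybrid (L - 1) C = minor fs ({..<L} - C)" for C
  proof -
    have "hybrid (L - 1) C = minor (map (\<lambda>f. f) fs) ({..<L} - C)"
      unfolding hybrid_def by (intro minor_cong) (auto simp: mult_linear_above_def)
    then show ?thesis by simp
  qed
  show ?thesis
  proof (cases cs)
    case Nil
    show ?thesis
    proof (cases "L = 0")
      case True
      then show ?thesis
        using Nil minor_cong[of fs "{}" "mult_linear_above t 0" "\<lambda>f. f"] by simp
    next
      case False
      then have "hybrid 0 {} = hybrid (L - 1) {}" by (intro hybrid_skip) auto
      then show ?thesis using Nil last[of "{}"] by (simp add: hybrid_def)
    qed
  next
    case (Cons c cs')
    have "hybrid 0 (set cs) = hybrid c (set cs)"
      using assms by (intro hybrid_skip) (auto simp: Cons)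
    also have "\<dots> = (\<Sum>es\<in>interlacing L cs. t ^ (sum_list es - sum_list cs) * minor fs ({..<L} - set es))"
      using hybrid_interlacing[of c cs' "{}"] assms by (simp only: Cons last Un_empty_left ball_empty simp_thms)
    finally show ?thesis by (simp add: hybrid_def)
  qed
qed

end

text \<open>Only the last row can use column 0. As this column is to the right of no other, removing
  it changes no sign.\<close>

lemma minor_append_unit:
  assumes "finite J" "\<forall>f\<in>set fs. f 0 = 0"
  shows "minor (fs @ [\<lambda>j. of_bool (j = 0)]) J = of_bool (0 \<in> J) * minor fs (J - {0})"
  using assms
proof (induction fs arbitrary: J)
  case Nil
  show ?case
  proof (cases "0 \<in> J")
    case True
    have "minor [\<lambda>j. of_bool (j = 0)] J = (\<Sum>j\<in>{0}. (- 1) ^ card {i \<in> J. j < i} * of_bool (J - {j} = {}) :: 'a)"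
      using True Nil.prems by (simp, intro sum.mono_neutral_cong_right) auto
    also have "\<dots> = of_bool (J - {0} = {})"
      by (auto simp: subset_singleton_iff cong: conj_cong)
    finally show ?thesis using True by simp
  qed (auto intro!: sum.neutral)
next
  case (Cons f fs)
  have eq: "f j * minor (fs @ [\<lambda>j. of_bool (j = 0)]) (J - {j}) =
      of_bool (0 \<in> J) * (if j = 0 then 0 else f j * minor fs (J - {0} - {j}))" for j
  proof (cases "j = 0")
    case False
    have "minor (fs @ [\<lambda>j. of_bool (j = 0)]) (J - {j}) = of_bool (0 \<in> J - {j}) * minor fs (J - {j} - {0})"
      using Cons.prems by (intro Cons.IH) auto
    moreover have "J - {j} - {0} = J - {0} - {j}" by auto
    ultimately show ?thesis using False by simp
  qed (use Cons.prems in simp)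
  have "minor ((f # fs) @ [\<lambda>j. of_bool (j = 0)]) J =
      of_bool (0 \<in> J) * (\<Sum>j\<in>J. (- 1) ^ card {i \<in> J. j < i} * (if j = 0 then 0 else f j * minor fs (J - {0} - {j})))"
    by (simp only: append_Cons minor.simps mult.assoc eq sum_distrib_left mult.left_commute)
  also have "(\<Sum>j\<in>J. (- 1) ^ card {i \<in> J. j < i} * (if j = 0 then 0 else f j * minor fs (J - {0} - {j}))) =
      minor (f # fs) (J - {0})"
    unfolding minor.simps
  proof (rule sum.mono_neutral_cong_right)
    fix j assume j: "j \<in> J - {0}"
    have "{i \<in> J. j < i} = {i \<in> J - {0}. j < i}" by auto
    with j show "(- 1) ^ card {i \<in> J. j < i} * (if j = 0 then 0 else f j * minor fs (J - {0} - {j})) =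
        (- 1) ^ card {i \<in> J - {0}. j < i} * f j * minor fs (J - {0} - {j})"
      by (simp add: mult.assoc)
  qed (use Cons.prems in auto)
  finally show ?case .
qed

lemma minor_shift:
  assumes "\<And>i j. i \<in> set is \<Longrightarrow> G i (Suc j) = F i j"
  shows "minor (map G is) (Suc ` J) = minor (map F is) J"
  using assms
proof (induction "is" arbitrary: J)
  case (Cons i "is")
  have "minor (map G (i # is)) (Suc ` J) =
      (\<Sum>j\<in>J. (- 1) ^ card {i \<in> Suc ` J. Suc j < i} * F i j * minor (map F is) (J - {j}))"
  proof -
    have "Suc ` J - {Suc j} = Suc ` (J - {j})" for j by auto
    then show ?thesis using Cons by (simp add: sum.reindex)
  qed
  moreover have "{i \<in> Suc ` J. Suc j < i} = Suc ` {i \<in> J. j < i}" for j by auto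
  ultimately show ?case by (simp add: card_image)
qed simp

section \<open>Reflections of diagonals\<close>

lemma mem_tri_cells: "(i, j) \<in> tri_cells n \<longleftrightarrow> 1 \<le> i \<and> i \<le> j \<and> j < n"
  by (auto simp: tri_cells_def)

text \<open>The conventional row 0 and column \<open>n\<close> encode the upper and lower bounds, so
  membership reduces to monotonicity of the extended entries.\<close>

lemma ext_entry_antimono:
  assumes "b \<in> tri_arrays n"
  shows ext_entry_row: "i \<le> j \<Longrightarrow> j < n \<Longrightarrow> ext_entry n b i (Suc j) \<le> ext_entry n b i j"
    and ext_entry_col: "Suc i \<le> j \<Longrightarrow> j < n \<Longrightarrow> ext_entry n b (Suc i) j \<le> ext_entry n b i j"
proof -
  have bounds: "b i j \<le> int n" "int n - int i \<le> b i j" if "1 \<le> i" "i \<le> j" "j < n" for i j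
    using assms that by (auto simp: tri_arrays_def tri_cells_def)
  have row: "b i (Suc j) \<le> b i j" if "1 \<le> i" "i \<le> j" "Suc j < n" for i j
  proof -
    have "\<forall>i j. (i, j) \<in> tri_cells n \<and> (i, j + 1) \<in> tri_cells n \<longrightarrow> b i (j + 1) \<le> b i j"
      using assms by (simp add: tri_arrays_def)
    from this[rule_format, of i j] that show ?thesis by (simp add: mem_tri_cells)
  qed
  have col: "b (Suc i) j \<le> b i j" if "1 \<le> i" "Suc i \<le> j" "j < n" for i j
    using assms that by (auto simp: tri_arrays_def tri_cells_def)
  show "i \<le> j \<Longrightarrow> j < n \<Longrightarrow> ext_entry n b i (Suc j) \<le> ext_entry n b i j"
    using bounds[of i j] row[of i j] by (auto simp: ext_entry_def)
  show "Suc i \<le> j \<Longrightarrow> j < n \<Longrightarrow> ext_entry n b (Suc i) j \<le> ext_entry n b i j"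
    using bounds[of "Suc i" j] col[of i j] by (auto simp: ext_entry_def)
qed

text \<open>Going up to row 0 recovers the upper bound, and going right to column \<open>n\<close>
  the lower one.\<close>

lemma tri_arraysI:
  assumes out: "\<And>i j. (i, j) \<notin> tri_cells n \<Longrightarrow> b i j = 0"
    and row: "\<And>i j. 1 \<le> i \<Longrightarrow> i \<le> j \<Longrightarrow> j < n \<Longrightarrow> ext_entry n b i (Suc j) \<le> ext_entry n b i j"
    and col: "\<And>i j. Suc i \<le> j \<Longrightarrow> j < n \<Longrightarrow> ext_entry n b (Suc i) j \<le> ext_entry n b i j"
  shows "b \<in> tri_arrays n"
proof -
  have e: "ext_entry n b i j = b i j" if "1 \<le> i" "j < n" for i j
    using that by (simp add: ext_entry_def)
  have upper: "i \<le> j \<Longrightarrow> j < n \<Longrightarrow> ext_entry n b i j \<le> int n" for i j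
  proof (induction i)
    case (Suc i)
    then show ?case using col[of i j] by simp
  qed (simp add: ext_entry_def)
  have lower: "int n - int i \<le> ext_entry n b i j" if i: "1 \<le> i" "i \<le> j" "j \<le> n" for i j
    using i(3)
  proof (induction j rule: inc_induct)
    case base
    then show ?case by (simp add: ext_entry_def)
  next
    case (step k)
    then show ?case using row[of i k] i by simp
  qed
  have "b i j \<le> int n" "int n - int i \<le> b i j" if "1 \<le> i" "i \<le> j" "j < n" for i j
    using upper[of i j] lower[of i j] e[of i j] that by auto
  moreover have "b i (Suc j) \<le> b i j" if "1 \<le> i" "i \<le> j" "Suc j < n" for i j
    using row[of i j] e that by auto
  moreover have "b (Suc i) j \<le> b i j" if "1 \<le> i" "Suc i \<le> j" "j < n" for i j
    using col[of i j] e that by auto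
  ultimately show ?thesis
    using out by (auto simp: tri_arrays_def mem_tri_cells)
qed

lemma ext_entry_bounds:
  assumes "b \<in> tri_arrays n" "i \<le> j" "j \<le> n"
  shows "ext_entry n b i j \<le> int n" "int n - int i \<le> ext_entry n b i j"
  using assms by (auto simp: ext_entry_def tri_arrays_def tri_cells_def)

text \<open>For the cell \<open>(s, s + r - 1)\<close> this is the upper neighbour. Its right
  neighbour is \<open>flip_up\<close> at \<open>Suc s\<close>; in the same way
  \<open>flip_left\<close> at \<open>s\<close> and \<open>Suc s\<close> gives the left and lower
  ones when \<open>r > 1\<close>.\<close>

definition flip_up :: "nat \<Rightarrow> nat \<Rightarrow> (nat \<Rightarrow> nat \<Rightarrow> int) \<Rightarrow> nat \<Rightarrow> int" where
  "flip_up n r b s = ext_entry n b (s - 1) (s + r - 1)"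

definition flip_left :: "nat \<Rightarrow> nat \<Rightarrow> (nat \<Rightarrow> nat \<Rightarrow> int) \<Rightarrow> nat \<Rightarrow> int" where
  "flip_left n r b s = (if r = 1 then flip_up n r b s else ext_entry n b s (s + r - 2))"

text \<open>
  Each entry of diagonal \<open>r\<close> is reflected in the interval that its four neighbours allow.  An entry
  of the main diagonal has no left or lower neighbour, so its other neighbours count twice there.
\<close>

definition flip :: "nat \<Rightarrow> nat \<Rightarrow> (nat \<Rightarrow> nat \<Rightarrow> int) \<Rightarrow> nat \<Rightarrow> nat \<Rightarrow> int" where
  "flip n r b i j = (if 1 \<le> i \<and> i + r \<le> n \<and> j = i + r - 1
     then min (flip_up n r b i) (flip_left n r b i) +
       max (flip_up n r b (Suc i)) (flip_left n r b (Suc i)) - b i j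
     else b i j)"

context
  fixes n r :: nat
  assumes r: "1 \<le> r" "r < n"
begin

lemma ext_entry_flip:
  "ext_entry n (flip n r b) i j = (if 1 \<le> i \<and> i + r \<le> n \<and> j = i + r - 1
     then min (flip_up n r b i) (flip_left n r b i) +
       max (flip_up n r b (Suc i)) (flip_left n r b (Suc i)) - ext_entry n b i j
     else ext_entry n b i j)"
  using r by (auto simp: ext_entry_def flip_def)

text \<open>The neighbours lie on adjacent diagonals, which the reflection leaves alone; this makes
  it an involution.\<close>

lemma flip_up_flip: "flip_up n r (flip n r b) s = flip_up n r b s"
  using r by (auto simp: flip_up_def ext_entry_flip)

lemma flip_left_flip: "flip_left n r (flip n r b) s = flip_left n r b s"
  unfolding flip_left_def flip_up_flip using r by (auto simp: ext_entry_flip)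

lemma flip_flip: "flip n r (flip n r b) = b"
  by (auto simp: fun_eq_iff flip_def[of n r "flip n r b"] flip_up_flip flip_left_flip)
     (auto simp: flip_def)

lemma flip_bounds:
  assumes b: "b \<in> tri_arrays n" and s: "1 \<le> s" "s + r \<le> n"
  shows "ext_entry n b s (s + r - 1) \<le> min (flip_up n r b s) (flip_left n r b s)"
    and "max (flip_up n r b (Suc s)) (flip_left n r b (Suc s)) \<le> ext_entry n b s (s + r - 1)"
proof -
  obtain s' where s': "s = Suc s'" using s by (cases s) auto
  obtain r' where r': "r = Suc r'" using r by (cases r) auto
  have "ext_entry n b s (s + r - 1) \<le> flip_up n r b s"
    using ext_entry_col[OF b, of s' "s' + r"] r s by (simp add: flip_up_def s')
  moreover have "ext_entry n b s (s + r - 1) \<le> flip_left n r b s" if "r \<noteq> 1"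
    using ext_entry_row[OF b, of s "s + r' - 1"] r s that by (auto simp: flip_left_def r' s')
  ultimately show "ext_entry n b s (s + r - 1) \<le> min (flip_up n r b s) (flip_left n r b s)"
    by (auto simp: flip_left_def)
  have "flip_up n r b (Suc s) \<le> ext_entry n b s (s + r - 1)"
    using ext_entry_row[OF b, of s "s + r - 1"] r s by (simp add: flip_up_def)
  moreover have "flip_left n r b (Suc s) \<le> ext_entry n b s (s + r - 1)" if "r \<noteq> 1"
    using ext_entry_col[OF b, of s "s + r - 1"] r s that by (simp add: flip_left_def)
  ultimately show "max (flip_up n r b (Suc s)) (flip_left n r b (Suc s)) \<le> ext_entry n b s (s + r - 1)"
    by (auto simp: flip_left_def)
qed

lemma flip_bounds':
  assumes b: "b \<in> tri_arrays n" and s: "1 \<le> s" "s + r \<le> n"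
  shows "ext_entry n (flip n r b) s (s + r - 1) \<le> flip_up n r b s"
    and "ext_entry n (flip n r b) s (s + r - 1) \<le> flip_left n r b s"
    and "flip_up n r b (Suc s) \<le> ext_entry n (flip n r b) s (s + r - 1)"
    and "flip_left n r b (Suc s) \<le> ext_entry n (flip n r b) s (s + r - 1)"
  using flip_bounds[OF assms] s unfolding ext_entry_flip
  by (simp_all split: if_splits) linarith+

lemma flip_in_tri_arrays:
  assumes b: "b \<in> tri_arrays n"
  shows "flip n r b \<in> tri_arrays n"
proof (rule tri_arraysI)
  fix i j assume "(i, j) \<notin> tri_cells n"
  then show "flip n r b i j = 0"
    using b r by (auto simp: flip_def tri_arrays_def tri_cells_def)
next
  fix i j assume ij: "1 \<le> i" "i \<le> j" "j < n"
  consider "i + r \<le> n" "j = i + r - 1" | "i + r \<le> n" "Suc j = i + r - 1"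
    | "\<not> (i + r \<le> n \<and> j = i + r - 1)" "\<not> (i + r \<le> n \<and> Suc j = i + r - 1)" by blast
  then show "ext_entry n (flip n r b) i (Suc j) \<le> ext_entry n (flip n r b) i j"
  proof cases
    case 1
    then show ?thesis
      using flip_bounds'(3)[OF b ij(1)] r by (auto simp: ext_entry_flip[of b i "i + r"] flip_up_def)
  next
    case 2
    then have "r \<noteq> 1" "j = i + r - 2" using ij by auto
    then show ?thesis
      using flip_bounds'(2)[OF b ij(1)] r ij 2 by (auto simp: ext_entry_flip[of b i "i + r - 2"] flip_left_def)
  next
    case 3
    then show ?thesis using ext_entry_row[OF b ij(2,3)] by (auto simp: ext_entry_flip)
  qed
next
  fix i j assume ij: "Suc i \<le> j" "j < n"
  consider "Suc i + r \<le> n" "j = i + r" | "1 \<le> i" "i + r \<le> n" "j = i + r - 1"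
    | "\<not> (Suc i + r \<le> n \<and> j = i + r)" "\<not> (1 \<le> i \<and> i + r \<le> n \<and> j = i + r - 1)" by blast
  then show "ext_entry n (flip n r b) (Suc i) j \<le> ext_entry n (flip n r b) i j"
  proof cases
    case 1
    then show ?thesis
      using flip_bounds'(1)[OF b, of "Suc i"] r by (auto simp: ext_entry_flip[of b i "i + r"] flip_up_def)
  next
    case 2
    then have "r \<noteq> 1" "j = Suc i + r - 2" using ij by auto
    then show ?thesis
      using flip_bounds'(4)[OF b 2(1,2)] r ij 2 by (auto simp: ext_entry_flip[of b "Suc i" "i + r - Suc 0"] flip_left_def)
  next
    case 3
    then show ?thesis using ext_entry_col[OF b ij] by (auto simp: ext_entry_flip)
  qed
qed

end

text \<open>What \<open>U_stat n 1\<close> becomes under the reflection, in the role of a \<open>U\<^sub>0\<close>.\<close>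

definition U0_stat :: "nat \<Rightarrow> (nat \<Rightarrow> nat \<Rightarrow> int) \<Rightarrow> int" where
  "U0_stat n b = (\<Sum>s = 1..n - 1. ext_entry n b (s - 1) s - ext_entry n b s s)"

text \<open>The maximum at \<open>Suc s\<close> meets the minimum of the next summand, and together
  they give the plain sum. Only the first minimum, equal to \<open>l 1\<close>, and the last maximum
  survive.\<close>

lemma sum_min_max:
  fixes a l :: "nat \<Rightarrow> int"
  assumes "l 1 \<le> a 1"
  shows "(\<Sum>s = 1..m. min (a s) (l s) + max (a (Suc s)) (l (Suc s))) =
    (\<Sum>s = 1..m. l s + a (Suc s)) + max 0 (l (Suc m) - a (Suc m))"
  using assms by (induction m) (auto simp: max_def min_def)

lemma U_stat_flip:
  assumes r: "1 \<le> r" "r < n" and b: "b \<in> tri_arrays n"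
  shows "U_stat n r (flip n r b) = (if r = 1 then U0_stat n b else U_stat n (r - 1) b)"
proof -
  define m where "m = n - r"
  have m: "1 \<le> m" "m + r = n" using r by (auto simp: m_def)
  let ?e = "ext_entry n b"
  let ?a = "flip_up n r b" and ?l = "flip_left n r b"
  let ?\<chi> = "\<lambda>s. of_bool (?e s (n - 1) > int n - int s) :: int"
  \<comment> \<open>Above the first cell stands row 0 with the largest value \<open>n\<close>; for
    \<open>r = 1\<close> both sides coincide.\<close>
  have "?l 1 \<le> ?a 1"
    using r ext_entry_bounds(1)[OF b, of 1 "r - 1"] by (auto simp: flip_left_def flip_up_def ext_entry_def)
  note mm = sum_min_max[of ?l ?a, OF this]
  have "U_stat n r (flip n r b) = (\<Sum>s = 1..m. min (?a s) (?l s) + max (?a (Suc s)) (?l (Suc s)) -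
      ?e s (s + r - 1) - ?a (Suc s)) + (\<Sum>s = Suc m..n - 1. ?\<chi> s)"
    unfolding U_stat_def m_def
    using r by (intro arg_cong2[where f = "(+)"] sum.cong) (auto simp: ext_entry_flip[OF r] flip_up_def)
  also have "\<dots> = (\<Sum>s = 1..m. min (?a s) (?l s) + max (?a (Suc s)) (?l (Suc s))) -
      (\<Sum>s = 1..m. ?e s (s + r - 1) + ?a (Suc s)) + (\<Sum>s = Suc m..n - 1. ?\<chi> s)"
    by (simp add: sum_subtractf sum.distrib)
  also have "\<dots> = (\<Sum>s = 1..m. ?l s - ?e s (s + r - 1)) + max 0 (?l (Suc m) - ?a (Suc m)) +
      (\<Sum>s = Suc m..n - 1. ?\<chi> s)"
    unfolding mm by (simp add: sum_subtractf sum.distrib)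
  finally have *: "U_stat n r (flip n r b) = \<dots>" .
  show ?thesis
  proof (cases "r = 1")
    case True
    \<comment> \<open>For \<open>r = 1\<close> the boundary term is zero since
      \<open>flip_left\<close> is \<open>flip_up\<close>, and the sum of indicators is
      empty.\<close>
    then show ?thesis
      using * m by (simp add: U0_stat_def flip_left_def) (auto simp: flip_up_def intro!: sum.cong)
  next
    case False
    \<comment> \<open>With \<open>e\<close> the entry at \<open>(m + 1, n - 1)\<close>, the boundary
      term \<open>max 0 (e - (n - m))\<close> and the indicator of \<open>e > n - m - 1\<close> add
      up to \<open>e - (n - m - 1)\<close>, as \<open>e \<ge> n - m - 1\<close>. This is the
      additional difference in the first sum of the statistic for \<open>r - 1\<close>.\<close>
    have l: "?l (Suc m) = ?e (Suc m) (n - 1)" and a: "?a (Suc m) = int n - int m"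
      using False m r by (auto simp: flip_left_def flip_up_def ext_entry_def)
    have "n - (r - 1) = Suc m" using m r by simp
    then have "U_stat n (r - 1) b = (\<Sum>s = 1..Suc m. ?e s (s + (r - 1) - 1) - ?e s (s + (r - 1))) +
        (\<Sum>s = Suc (Suc m)..n - 1. ?\<chi> s)"
      unfolding U_stat_def by simp
    also have "(\<Sum>s = 1..Suc m. ?e s (s + (r - 1) - 1) - ?e s (s + (r - 1))) =
        (\<Sum>s = 1..m. ?l s - ?e s (s + r - 1)) + (?e (Suc m) (n - 1) - ?e (Suc m) n)"
    proof -
      have "Suc m + (r - 1) - 1 = n - 1" "Suc m + (r - 1) = n" using m r by auto
      then show ?thesis using False r
        by (simp add: flip_left_def numeral_2_eq_2 m(2))
    qed
    also have "?e (Suc m) n = int n - int (Suc m)" by (simp add: ext_entry_def)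
    finally have U: "U_stat n (r - 1) b = (\<Sum>s = 1..m. ?l s - ?e s (s + r - 1)) +
        (?e (Suc m) (n - 1) - (int n - int (Suc m))) + (\<Sum>s = Suc (Suc m)..n - 1. ?\<chi> s)" .
    have "int n - int (Suc m) \<le> ?e (Suc m) (n - 1)"
      using ext_entry_bounds(2)[OF b, of "Suc m" "n - 1"] m False r by auto
    moreover have "(\<Sum>s = Suc m..n - 1. ?\<chi> s) = ?\<chi> (Suc m) + (\<Sum>s = Suc (Suc m)..n - 1. ?\<chi> s)"
      using m False r by (intro sum.atLeast_Suc_atMost) auto
    ultimately show ?thesis using False * U l a by (auto simp: max_def)
  qed
qed

lemma sum_U_stat_flip:
  assumes r: "1 \<le> r" "r < n"
  shows "(\<Sum>b\<in>tri_arrays n. f (U_stat n r b)) =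
    (\<Sum>b\<in>tri_arrays n. f (if r = 1 then U0_stat n b else U_stat n (r - 1) b))"
proof -
  have "(\<Sum>b\<in>tri_arrays n. f (U_stat n r b)) = (\<Sum>b\<in>tri_arrays n. f (U_stat n r (flip n r b)))"
    by (rule sum.reindex_bij_witness[where i = "flip n r" and j = "flip n r"])
      (auto simp: flip_flip[OF r] flip_in_tri_arrays[OF r])
  then show ?thesis by (simp add: U_stat_flip[OF r])
qed

lemma sum_U_stat:
  assumes "1 \<le> r" "r \<le> n"
  shows "(\<Sum>b\<in>tri_arrays n. f (U_stat n r b)) = (\<Sum>b\<in>tri_arrays n. f (U0_stat n b))"
proof -
  have less: "r < n \<Longrightarrow> (\<Sum>b\<in>tri_arrays n. f (U_stat n r b)) = (\<Sum>b\<in>tri_arrays n. f (U0_stat n b))"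
    if "1 \<le> r" for r
    using that
  proof (induction r rule: dec_induct)
    case base
    then show ?case by (subst sum_U_stat_flip) auto
  next
    case (step k)
    then show ?case by (subst sum_U_stat_flip) auto
  qed
  show ?thesis
  proof (cases "r = n")
    case False
    then show ?thesis using assms less by auto
  next
    case True
    show ?thesis
    proof (cases "n = 1")
      case True
      then show ?thesis using \<open>r = n\<close> by (simp add: U_stat_def U0_stat_def)
    next
      case False
      \<comment> \<open>No cell lies on diagonal \<open>n\<close>. The entry at
        \<open>(1, n - 1)\<close> is \<open>n - 1\<close> or \<open>n\<close>, so its difference to
        \<open>n - 1\<close> equals its indicator.\<close>
      have "U_stat n n b = U_stat n (n - 1) b" if b: "b \<in> tri_arrays n" for b
      proof -
        have "n - (n - 1) = 1" using assms by simp
        moreover have "(\<Sum>s = 1..n - 1. g s) = g 1 + (\<Sum>s = Suc 1..n - 1. g s)" for g :: "nat \<Rightarrow> int"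
          using False assms by (intro sum.atLeast_Suc_atMost) auto
        moreover have "ext_entry n b 1 (n - 1) \<le> int n" "int n - int 1 \<le> ext_entry n b 1 (n - 1)"
          using ext_entry_bounds[OF b, of 1 "n - 1"] False assms by auto
        moreover have "ext_entry n b 1 n = int n - 1" by (simp add: ext_entry_def)
        ultimately show ?thesis
          using False assms unfolding U_stat_def by auto
      qed
      then show ?thesis using \<open>r = n\<close> less[of "n - 1"] False assms by simp
    qed
  qed
qed

section \<open>Removing the main diagonal\<close>

text \<open>
  The main diagonal read upwards and made strictly increasing.  For \<open>i \<ge> n - 1\<close> the truncated
  subtraction gives the conventional entry \<open>b\<^sub>0\<^sub>0 = n\<close>, which pads the list to length \<open>N\<close>.
\<close>

definition diag_list :: "nat \<Rightarrow> nat \<Rightarrow> (nat \<Rightarrow> nat \<Rightarrow> int) \<Rightarrow> nat list" where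
  "diag_list n N b = map (\<lambda>i. nat (int i + ext_entry n b (n - 1 - i) (n - 1 - i))) [0..<N]"

text \<open>The possible main diagonals of the arrays that arise from one with diagonal \<open>es\<close> by adding a new
  main diagonal.\<close>

definition above :: "nat \<Rightarrow> nat list \<Rightarrow> nat list set" where
  "above N es = {cs. length cs = N \<and>
     (\<forall>i<N. 1 \<le> cs ! i \<and> cs ! i \<le> Suc (es ! i) \<and> (Suc i < N \<longrightarrow> Suc (es ! i) < cs ! Suc i))}"

text \<open>The column shift drops the main diagonal; subtracting 1 turns the bounds for size
  \<open>n + 1\<close> into those for size \<open>n\<close>.\<close>

definition inner_array :: "nat \<Rightarrow> (nat \<Rightarrow> nat \<Rightarrow> int) \<Rightarrow> nat \<Rightarrow> nat \<Rightarrow> int" where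
  "inner_array n b i j = (if (i, j) \<in> tri_cells n then b i (Suc j) - 1 else 0)"

definition outer_array :: "nat \<Rightarrow> (nat \<Rightarrow> nat \<Rightarrow> int) \<Rightarrow> nat list \<Rightarrow> nat \<Rightarrow> nat \<Rightarrow> int" where
  "outer_array n b cs i j = (if (i, j) \<in> tri_cells (Suc n)
     then if i = j then int (cs ! (n - i)) - int (n - i) else b i (j - 1) + 1 else 0)"

lemma length_diag_list [simp]: "length (diag_list n N b) = N"
  by (simp add: diag_list_def)

lemma nth_diag_list:
  assumes "b \<in> tri_arrays n" "i < N"
  shows "int (diag_list n N b ! i) = int i + ext_entry n b (n - 1 - i) (n - 1 - i)"
  using assms ext_entry_bounds(2)[OF assms(1), of "n - 1 - i" "n - 1 - i"]
  by (simp add: diag_list_def)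

lemma ext_entry_inner:
  "i \<le> j \<Longrightarrow> j \<le> n \<Longrightarrow> ext_entry n (inner_array n b) i j = ext_entry (Suc n) b i (Suc j) - 1"
  by (auto simp: ext_entry_def inner_array_def mem_tri_cells)

lemma inner_in_tri_arrays:
  assumes b: "b \<in> tri_arrays (Suc n)"
  shows "inner_array n b \<in> tri_arrays n"
proof (rule tri_arraysI)
  fix i j assume "1 \<le> i" "i \<le> j" "j < n"
  then show "ext_entry n (inner_array n b) i (Suc j) \<le> ext_entry n (inner_array n b) i j"
    using ext_entry_row[OF b, of i "Suc j"] by (simp add: ext_entry_inner)
next
  fix i j assume "Suc i \<le> j" "j < n"
  then show "ext_entry n (inner_array n b) (Suc i) j \<le> ext_entry n (inner_array n b) i j"
    using ext_entry_col[OF b, of i "Suc j"] by (simp add: ext_entry_inner)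
qed (simp add: inner_array_def)

lemma nth_diag_list_inner:
  assumes b: "b \<in> tri_arrays (Suc n)" and i: "i < N"
  shows "int (Suc (diag_list n N (inner_array n b) ! i)) =
    int i + (if i < n then ext_entry (Suc n) b (n - 1 - i) (n - i) else int n + 1)"
proof (cases "i < n")
  case True
  then have "Suc (n - 1 - i) = n - i" by simp
  with True show ?thesis
    using nth_diag_list[OF inner_in_tri_arrays[OF b] i] ext_entry_inner[of "n - 1 - i" "n - 1 - i" n b]
    by simp
next
  case False
  then show ?thesis
    using nth_diag_list[OF inner_in_tri_arrays[OF b] i] by (simp add: ext_entry_def)
qed

text \<open>The three inequalities are the lower bound of a diagonal entry, its comparison with the
  entry above, and that of this entry with its left neighbour. The index added in
  \<open>diag_list\<close> makes the last one strict.\<close>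

lemma diag_list_in_above:
  assumes b: "b \<in> tri_arrays (Suc n)"
  shows "diag_list (Suc n) N b \<in> above N (diag_list n N (inner_array n b))"
  unfolding above_def
proof (simp, intro allI impI)
  fix i assume i: "i < N"
  let ?e = "ext_entry (Suc n) b"
  have c: "int (diag_list (Suc n) N b ! i) = int i + ?e (n - i) (n - i)"
    using nth_diag_list[OF b i] by simp
  note e = nth_diag_list_inner[OF b i]
  have "n - i \<le> Suc n" "int (n - i) \<le> int n" by auto
  then have "1 \<le> diag_list (Suc n) N b ! i"
    using c ext_entry_bounds(2)[OF b order.refl, of "n - i"] by linarith
  moreover have "diag_list (Suc n) N b ! i \<le> Suc (diag_list n N (inner_array n b) ! i)"
  proof (cases "i < n")
    case True
    then show ?thesis
      using ext_entry_col[OF b, of "n - 1 - i" "n - i"] c e by (auto simp: Suc_diff_Suc less_Suc_eq_le)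
  qed (use c e ext_entry_bounds(1)[OF b, of "n - i" "n - i"] in simp)
  moreover have "Suc (diag_list n N (inner_array n b) ! i) < diag_list (Suc n) N b ! Suc i" if "Suc i < N"
  proof -
    have c': "int (diag_list (Suc n) N b ! Suc i) = int (Suc i) + ?e (n - Suc i) (n - Suc i)"
      using nth_diag_list[OF b that] by simp
    show ?thesis
    proof (cases "i < n")
      case True
      then show ?thesis
        using ext_entry_row[OF b, of "n - Suc i" "n - Suc i"] c' e by (auto simp: Suc_diff_Suc less_Suc_eq_le)
    qed (use c' e in \<open>simp add: ext_entry_def\<close>)
  qed
  ultimately show "Suc 0 \<le> diag_list (Suc n) N b ! i \<and>
      diag_list (Suc n) N b ! i \<le> Suc (diag_list n N (inner_array n b) ! i) \<and>
      (Suc i < N \<longrightarrow> Suc (diag_list n N (inner_array n b) ! i) < diag_list (Suc n) N b ! Suc i)"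
    by simp
qed

lemma ext_entry_outer:
  assumes "i \<le> j" "j \<le> Suc n"
  shows "ext_entry (Suc n) (outer_array n b cs) i j =
    (if i < j then ext_entry n b i (j - 1) + 1
     else if i = 0 then int n + 1 else if j = Suc n then 0 else int (cs ! (n - i)) - int (n - i))"
  using assms by (auto simp: ext_entry_def outer_array_def mem_tri_cells)

context
  fixes n N :: nat and b :: "nat \<Rightarrow> nat \<Rightarrow> int" and cs :: "nat list"
  assumes nN: "n \<le> N" and b: "b \<in> tri_arrays n" and cs: "cs \<in> above N (diag_list n N b)"
begin

lemma above_bounds:
  assumes i: "i < N"
  shows "int (cs ! i) \<le> int i + ext_entry n b (n - 1 - i) (n - 1 - i) + 1"
    and "Suc i < N \<Longrightarrow> int i + ext_entry n b (n - 1 - i) (n - 1 - i) + 1 < int (cs ! Suc i)"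
    and "1 \<le> cs ! i"
proof -
  have "1 \<le> cs ! i \<and> cs ! i \<le> Suc (diag_list n N b ! i) \<and> (Suc i < N \<longrightarrow> Suc (diag_list n N b ! i) < cs ! Suc i)"
    using cs i unfolding above_def by blast
  with nth_diag_list[OF b i]
  show "int (cs ! i) \<le> int i + ext_entry n b (n - 1 - i) (n - 1 - i) + 1"
    and "Suc i < N \<Longrightarrow> int i + ext_entry n b (n - 1 - i) (n - 1 - i) + 1 < int (cs ! Suc i)"
    and "1 \<le> cs ! i"
    by linarith+
qed

lemma outer_in_tri_arrays: "outer_array n b cs \<in> tri_arrays (Suc n)"
proof (rule tri_arraysI)
  fix i j assume ij: "1 \<le> i" "i \<le> j" "j < Suc n"
  show "ext_entry (Suc n) (outer_array n b cs) i (Suc j) \<le> ext_entry (Suc n) (outer_array n b cs) i j"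
  proof (cases "i = j")
    case False
    then show ?thesis using ij ext_entry_row[OF b, of i "j - 1"] by (auto simp: ext_entry_outer)
  next
    case True
    show ?thesis
    proof (cases "i = n")
      case True
      then show ?thesis using ij \<open>i = j\<close> above_bounds(3)[of 0] nN
        by (simp add: ext_entry_outer) (simp add: ext_entry_def)
    next
      case False
      then have "n - Suc i < N" "Suc (n - Suc i) < N" using ij \<open>i = j\<close> nN by linarith+
      then show ?thesis using False ij \<open>i = j\<close> above_bounds(2)[of "n - Suc i"]
        by (simp add: ext_entry_outer Suc_diff_Suc)
    qed
  qed
next
  fix i j assume ij: "Suc i \<le> j" "j < Suc n"
  show "ext_entry (Suc n) (outer_array n b cs) (Suc i) j \<le> ext_entry (Suc n) (outer_array n b cs) i j"
  proof (cases "Suc i = j")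
    case False
    then show ?thesis using ij ext_entry_col[OF b, of i "j - 1"] by (auto simp: ext_entry_outer)
  next
    case True
    moreover from this have "n - j < N" using ij nN by linarith
    ultimately show ?thesis using ij above_bounds(1)[of "n - j"] by (auto simp: ext_entry_outer)
  qed
qed (simp add: outer_array_def)

lemma diag_list_outer: "diag_list (Suc n) N (outer_array n b cs) = cs"
proof (rule nth_equalityI)
  show "length (diag_list (Suc n) N (outer_array n b cs)) = length cs"
    using cs by (simp add: above_def)
  fix i assume "i < length (diag_list (Suc n) N (outer_array n b cs))"
  then have i: "i < N" by simp
  have c: "int (diag_list (Suc n) N (outer_array n b cs) ! i) =
      int i + ext_entry (Suc n) (outer_array n b cs) (n - i) (n - i)"
    using nth_diag_list[OF outer_in_tri_arrays i] by simp
  show "diag_list (Suc n) N (outer_array n b cs) ! i = cs ! i"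
  proof (cases "i < n")
    case True
    then have "n - i \<noteq> Suc n" by linarith
    with True show ?thesis using c by (simp add: ext_entry_outer)
  next
    case False
    \<comment> \<open>A padded place is forced: the upper bound is \<open>i + n + 1\<close>, and the
      previous place, or positivity when \<open>i = 0\<close>, excludes smaller values.\<close>
    have "int (cs ! i) = int i + int n + 1"
    proof (cases i)
      case 0
      then show ?thesis using False above_bounds(1,3)[OF i] by (simp add: ext_entry_def)
    next
      case (Suc k)
      then show ?thesis using False i above_bounds(1)[OF i] above_bounds(2)[of k]
        by (cases "k = n - 1") (auto simp: ext_entry_def split: if_splits)
    qed
    then show ?thesis using c False by (simp add: ext_entry_outer)
  qed
qed

lemma inner_outer: "inner_array n (outer_array n b cs) = b"
  using b by (auto simp: fun_eq_iff inner_array_def outer_array_def mem_tri_cells tri_arrays_def)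

end

lemma outer_inner:
  assumes "n \<le> N" and b: "b \<in> tri_arrays (Suc n)"
  shows "outer_array n (inner_array n b) (diag_list (Suc n) N b) = b"
proof (intro ext)
  fix i j
  show "outer_array n (inner_array n b) (diag_list (Suc n) N b) i j = b i j"
  proof (cases "(i, j) \<in> tri_cells (Suc n)")
    case True
    then have ij: "1 \<le> i" "i \<le> j" "j \<le> n" by (auto simp: mem_tri_cells)
    then have "n - i < N" using assms(1) by simp
    from nth_diag_list[OF b this] ij True show ?thesis
      by (auto simp: outer_array_def inner_array_def mem_tri_cells ext_entry_def)
  next
    case False
    then show ?thesis using b by (simp add: outer_array_def tri_arrays_def)
  qed
qed

text \<open>Position \<open>i\<close> contributes the summand \<open>s = n - i\<close> of
  \<open>U0_stat\<close>, and padded positions cancel. Lowering each \<open>c\<close> by 1 matches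
  the removal of column 0 in the minors.\<close>

lemma sum_list_diag_list_diff:
  assumes "n \<le> N" and b: "b \<in> tri_arrays (Suc n)"
  shows "int (sum_list (diag_list n N (inner_array n b))) -
      int (sum_list (map (\<lambda>c. c - 1) (diag_list (Suc n) N b))) = U0_stat (Suc n) b"
proof -
  let ?e = "ext_entry (Suc n) b"
  let ?es = "diag_list n N (inner_array n b)" and ?cs = "diag_list (Suc n) N b"
  have ge: "1 \<le> ?cs ! i" if "i < N" for i
    using diag_list_in_above[OF b, of N] that by (simp add: above_def)
  have c: "int (?cs ! i) = int i + ?e (n - i) (n - i)" if "i < N" for i
    using nth_diag_list[OF b that] by simp
  have "int (sum_list ?es) - int (sum_list (map (\<lambda>c. c - 1) ?cs)) =
      (\<Sum>i<N. int (Suc (?es ! i)) - int (?cs ! i))"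
  proof -
    have "sum_list ?es = (\<Sum>i<N. ?es ! i)" "sum_list (map (\<lambda>c. c - 1) ?cs) = (\<Sum>i<N. ?cs ! i - 1)"
      by (simp_all add: sum_list_sum_nth atLeast0LessThan)
    then have "int (sum_list ?es) - int (sum_list (map (\<lambda>c. c - 1) ?cs)) =
        (\<Sum>i<N. int (?es ! i) - int (?cs ! i - 1))"
      by (simp only: of_nat_sum sum_subtractf)
    also have "\<dots> = (\<Sum>i<N. int (Suc (?es ! i)) - int (?cs ! i))"
      using ge by (intro sum.cong) (auto simp: of_nat_diff)
    finally show ?thesis .
  qed
  also have "\<dots> = (\<Sum>i<n. ?e (n - 1 - i) (n - i) - ?e (n - i) (n - i))"
  proof (rule sum.mono_neutral_cong_right)
    fix i assume "i \<in> {..<n}"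
    then show "int (Suc (?es ! i)) - int (?cs ! i) = ?e (n - 1 - i) (n - i) - ?e (n - i) (n - i)"
      using nth_diag_list_inner[OF b, of i N] c[of i] assms(1) by simp
  next
    show "\<forall>i\<in>{..<N} - {..<n}. int (Suc (?es ! i)) - int (?cs ! i) = 0"
      using nth_diag_list_inner[OF b, of _ N] c by (auto simp: ext_entry_def)
  qed (use assms(1) in auto)
  also have "\<dots> = U0_stat (Suc n) b"
    unfolding U0_stat_def
    by (rule sum.reindex_bij_witness[where i = "\<lambda>s. n - s" and j = "\<lambda>i. n - i"]) auto
  finally show ?thesis .
qed

lemma sum_tri_arrays_Suc:
  assumes "n \<le> N"
  shows "(\<Sum>b\<in>tri_arrays (Suc n). f (inner_array n b) (diag_list (Suc n) N b)) =
    (\<Sum>b\<in>tri_arrays n. \<Sum>cs\<in>above N (diag_list n N b). f b cs)"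
proof -
  have fin: "finite (above N es)" for es
  proof (rule finite_subset)
    show "above N es \<subseteq> {cs. set cs \<subseteq> {..Suc (\<Sum>i<N. es ! i)} \<and> length cs = N}"
    proof
      fix cs assume cs: "cs \<in> above N es"
      have "cs ! i \<le> Suc (\<Sum>i<N. es ! i)" if "i < N" for i
        using cs that member_le_sum[of i "{..<N}" "\<lambda>i. es ! i"] by (force simp: above_def)
      then show "cs \<in> {cs. set cs \<subseteq> {..Suc (\<Sum>i<N. es ! i)} \<and> length cs = N}"
        using cs by (auto simp: above_def in_set_conv_nth)
    qed
  qed (intro finite_lists_length_eq, simp)
  have "(\<Sum>b\<in>tri_arrays (Suc n). f (inner_array n b) (diag_list (Suc n) N b)) =
      (\<Sum>(b, cs)\<in>(SIGMA b:tri_arrays n. above N (diag_list n N b)). f b cs)"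
    by (rule sum.reindex_bij_witness[where i = "\<lambda>(b, cs). outer_array n b cs"
          and j = "\<lambda>b. (inner_array n b, diag_list (Suc n) N b)"])
      (auto simp: outer_inner[OF assms] inner_outer[OF assms] diag_list_outer[OF assms] outer_in_tri_arrays[OF assms]
        inner_in_tri_arrays diag_list_in_above)
  also have "\<dots> = (\<Sum>b\<in>tri_arrays n. \<Sum>cs\<in>above N (diag_list n N b). f b cs)"
    using fin by (subst sum.Sigma) (auto simp: finite_tri_arrays)
  finally show ?thesis .
qed

section \<open>The minors of the matrix \<open>B\<close>\<close>

text \<open>For \<open>i > 0\<close> these are the coefficients of
  \<open>z^i (1 + z)^(i-1) (1 + t z)\<close>.\<close>

definition B_row :: "'a::comm_ring_1 \<Rightarrow> nat \<Rightarrow> nat \<Rightarrow> 'a" where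
  "B_row t i j = (if i = 0 then of_bool (j = 0)
     else of_nat (binom_int (i - 1) (int j - int i)) + of_nat (binom_int (i - 1) (int j - int i - 1)) * t)"

lemma binom_int_of_nat [simp]: "binom_int k (int p) = k choose p"
  by (simp add: binom_int_def)

lemma binom_int_neg: "m < 0 \<Longrightarrow> binom_int k m = 0"
  by (simp add: binom_int_def)

lemma binom_int_Suc: "binom_int (Suc k) m = binom_int k m + binom_int k (m - 1)"
proof -
  consider "m < 0" | "m = int 0" | p where "m = int (Suc p)"
    by (metis linorder_not_less nonneg_int_cases not0_implies_Suc)
  then show ?thesis
  proof cases
    case 3
    have "int (Suc p) - 1 = int p" by simp
    with 3 show ?thesis by (simp only: binom_int_of_nat binomial_Suc_Suc add.commute)
  next
    case 2
    then show ?thesis by (simp only: binom_int_of_nat) (simp add: binom_int_neg)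
  qed (simp add: binom_int_neg)
qed

text \<open>At \<open>t = 1\<close> the polynomial is \<open>z^i (1 + z)^i\<close>, which also
  covers the exceptional row 0.\<close>

lemma B_row_1: "B_row 1 i j = of_nat (binom_int i (int j - int i))"
proof (cases i)
  case 0
  have "0 choose j = of_bool (j = 0)" by (cases j) auto
  with 0 show ?thesis by (simp add: B_row_def)
next
  case (Suc k)
  then show ?thesis by (simp add: B_row_def binom_int_Suc[of k])
qed

lemma B_row_Suc: "B_row t (Suc i) 0 = 0" "B_row t (Suc i) (Suc j) = mult_linear_above t 0 (B_row 1 i) j"
proof -
  show "B_row t (Suc i) 0 = 0" by (simp add: B_row_def binom_int_neg)
  have *: "B_row t (Suc i) (Suc j) =
      of_nat (binom_int i (int j - int i)) + of_nat (binom_int i (int j - int i - 1)) * t"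
    by (simp add: B_row_def)
  show "B_row t (Suc i) (Suc j) = mult_linear_above t 0 (B_row 1 i) j"
  proof (cases j)
    case 0
    then show ?thesis unfolding * mult_linear_above_def B_row_1 by (simp add: binom_int_neg)
  next
    case (Suc k)
    then have eq: "int j - int i - 1 = int k - int i" by simp
    show ?thesis unfolding * mult_linear_above_def B_row_1 eq by (simp add: Suc mult.commute)
  qed
qed

abbreviation B_minor :: "'a::comm_ring_1 \<Rightarrow> nat \<Rightarrow> nat set \<Rightarrow> 'a" where
  "B_minor t n \<equiv> minor (map (B_row t) (rev [0..<n]))"

text \<open>
  Row 0 occupies column 0, and row \<open>i + 1\<close> is \<open>z (1 + t z)\<close> times the row \<open>i\<close> that belongs to \<open>t = 1\<close>.
\<close>

lemma B_minor_Suc: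
  assumes cs: "sorted_wrt (<) cs" "set cs \<subseteq> {..<Suc L}"
  shows "B_minor t (Suc n) ({..<Suc L} - set cs) = (if 0 \<in> set cs then 0 else
    \<Sum>es\<in>interlacing L (map (\<lambda>c. c - 1) cs).
      t ^ (sum_list es - sum_list (map (\<lambda>c. c - 1) cs)) * B_minor 1 n ({..<L} - set es))"
proof -
  let ?J = "{..<Suc L} - set cs" and ?ds = "map (\<lambda>c. c - 1) cs"
  let ?G = "\<lambda>i. B_row t (Suc i)" and ?is = "rev [0..<n]"
  have "rev [0..<Suc n] = map Suc ?is @ [0]"
    by (simp only: upt_conv_Cons zero_less_Suc map_Suc_upt[symmetric] rev.simps rev_map)
  then have "map (B_row t) (rev [0..<Suc n]) = map ?G ?is @ [\<lambda>j. of_bool (j = 0)]"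
    by (simp add: B_row_def fun_eq_iff del: upt_Suc)
  then have *: "B_minor t (Suc n) ?J = of_bool (0 \<in> ?J) * minor (map ?G ?is) (?J - {0})"
    by (simp add: minor_append_unit B_row_Suc del: upt_Suc)
  show ?thesis
  proof (cases "0 \<in> set cs")
    case False
    have pos: "c \<in> set cs \<Longrightarrow> Suc (c - 1) = c" for c using False by (cases c) auto
    have ds: "k \<in> set ?ds \<longleftrightarrow> Suc k \<in> set cs" for k
    proof
      assume "k \<in> set ?ds"
      then obtain c where "c \<in> set cs" "k = c - 1" by auto
      then show "Suc k \<in> set cs" using pos by simp
    next
      assume "Suc k \<in> set cs"
      then show "k \<in> set ?ds" using image_eqI[of k "\<lambda>c. c - 1" "Suc k" "set cs"] by simp
    qed
    have J: "?J - {0} = Suc ` ({..<L} - set ?ds)"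
    proof (intro equalityI subsetI)
      fix j assume j: "j \<in> ?J - {0}"
      then obtain k where "j = Suc k" by (cases j) auto
      with j ds show "j \<in> Suc ` ({..<L} - set ?ds)" by blast
    qed (use ds in auto)
    have "minor (map ?G ?is) (Suc ` ({..<L} - set ?ds)) =
        minor (map (\<lambda>i. mult_linear_above t 0 (B_row 1 i)) ?is) ({..<L} - set ?ds)"
      by (rule minor_shift) (rule B_row_Suc)
    also have "map (\<lambda>i. mult_linear_above t 0 (B_row 1 i)) ?is =
        map (mult_linear_above t 0) (map (B_row 1) ?is)" by simp
    also have "minor \<dots> ({..<L} - set ?ds) = (\<Sum>es\<in>interlacing L ?ds.
        t ^ (sum_list es - sum_list ?ds) * B_minor 1 n ({..<L} - set es))"
    proof (rule minor_mult_linear)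
      have "c - 1 < d - 1" if "c < d" "c \<in> set cs" for c d
        using that(1) pos[OF that(2)] by linarith
      then show "sorted_wrt (<) ?ds"
        unfolding sorted_wrt_map by (intro sorted_wrt_mono_rel[OF _ cs(1)])
      show "set ?ds \<subseteq> {..<L}"
        using cs(2) ds by auto
    qed
    finally show ?thesis
      using False by (simp only: * J) simp
  qed (simp add: * del: upt_Suc)
qed

section \<open>Minors as weighted counts of arrays with given main diagonal\<close>

definition strict_lists :: "nat \<Rightarrow> nat \<Rightarrow> nat list set" where
  "strict_lists L N = {cs. sorted_wrt (<) cs \<and> set cs \<subseteq> {..<L} \<and> length cs = N}"

lemma finite_strict_lists: "finite (strict_lists L N)"
  by (rule finite_subset[OF _ finite_lists_length_eq[of "{..<L}" N]]) (auto simp: strict_lists_def)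

text \<open>The two halves meet here: adding a diagonal to an array is the interlacing of column
  operations read backwards. The last upper bound \<open>L\<close> comes from the range of
  \<open>es\<close>.\<close>

lemma above_iff:
  assumes es: "es \<in> strict_lists L N"
  shows "cs \<in> above N es \<longleftrightarrow> cs \<in> strict_lists (Suc L) N \<and> 0 \<notin> set cs \<and> es \<in> interlacing L (map (\<lambda>c. c - 1) cs)"
proof
  have esL: "i < N \<Longrightarrow> es ! i < L" for i
  proof -
    assume "i < N"
    then have "es ! i \<in> set es" using es by (intro nth_mem) (simp add: strict_lists_def)
    moreover have "set es \<subseteq> {..<L}" using es by (simp add: strict_lists_def)
    ultimately show "es ! i < L" by blast
  qed
  {
    assume cs: "cs \<in> above N es"
    then have len: "length cs = N"
      and c: "\<And>i. i < N \<Longrightarrow> 1 \<le> cs ! i" "\<And>i. i < N \<Longrightarrow> cs ! i \<le> Suc (es ! i)"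
        "\<And>i. Suc i < N \<Longrightarrow> Suc (es ! i) < cs ! Suc i"
      by (auto simp: above_def)
    have "cs ! i < cs ! Suc i" if "Suc i < N" for i
      using c(2)[of i] c(3)[of i] that by linarith
    then have "sorted_wrt (<) cs"
      by (subst sorted_wrt_iff_nth_Suc_transp) (auto simp: len intro: transpI)
    moreover have "set cs \<subseteq> {..<Suc L}"
      using c(2) esL by (fastforce simp: in_set_conv_nth len)
    moreover have "0 \<notin> set cs"
      using c(1) by (fastforce simp: in_set_conv_nth len)
    moreover have "es \<in> interlacing L (map (\<lambda>c. c - 1) cs)"
      unfolding in_interlacing_iff
    proof (intro conjI allI impI)
      fix i assume "i < length (map (\<lambda>c. c - 1) cs)"
      then have i: "i < N" by (simp add: len)
      show "map (\<lambda>c. c - 1) cs ! i \<le> es ! i" using c(2)[OF i] i len by simp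
      show "es ! i < (map (\<lambda>c. c - 1) cs @ [L]) ! Suc i"
        using esL[OF i] c(3)[of i] i len by (auto simp: nth_append less_diff_conv)
    qed (use es len in \<open>simp add: strict_lists_def\<close>)
    ultimately show "cs \<in> strict_lists (Suc L) N \<and> 0 \<notin> set cs \<and> es \<in> interlacing L (map (\<lambda>c. c - 1) cs)"
      using len by (simp add: strict_lists_def)
  }
  assume cs: "cs \<in> strict_lists (Suc L) N \<and> 0 \<notin> set cs \<and> es \<in> interlacing L (map (\<lambda>c. c - 1) cs)"
  then have len: "length cs = N" by (simp add: strict_lists_def)
  have pos: "1 \<le> cs ! i" if "i < N" for i
    using cs that len by (metis One_nat_def Suc_leI gr0I nth_mem)
  have "cs ! i - 1 \<le> es ! i \<and> es ! i < (map (\<lambda>c. c - 1) cs @ [L]) ! Suc i" if "i < N" for i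
    using cs that len by (auto simp: in_interlacing_iff)
  note key = this
  have "cs ! i \<le> Suc (es ! i)" if "i < N" for i
    using key[OF that] by linarith
  moreover have "Suc (es ! i) < cs ! Suc i" if "Suc i < N" for i
  proof -
    have "es ! i < cs ! Suc i - 1" using key[of i] that by (simp add: nth_append len)
    then show ?thesis by linarith
  qed
  ultimately show "cs \<in> above N es"
    using pos len by (simp add: above_def)
qed

text \<open>For \<open>h\<close> the indicator of one list this evaluates one minor. A general
  \<open>h\<close> is kept because the induction step absorbs the sum over all new diagonals into
  it; \<open>t\<close> varies because the hypothesis is used at 1.\<close>

lemma sum_B_minor:
  assumes "n \<le> Suc N"
  shows "(\<Sum>cs\<in>strict_lists (n + N) N. h cs * B_minor t n ({..<n + N} - set cs)) =
    (\<Sum>b\<in>tri_arrays n. t ^ nat (U0_stat n b) * h (diag_list n N b))"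
  using assms
proof (induction n arbitrary: h t)
  case 0
  have T: "tri_arrays 0 = {\<lambda>_ _. 0}"
    by (auto simp: tri_arrays_def tri_cells_def fun_eq_iff)
  have D: "diag_list 0 N (\<lambda>_ _. 0) = [0..<N]"
    by (simp add: diag_list_def ext_entry_def map_idI)
  have "cs = [0..<N]" if cs: "cs \<in> strict_lists N N" for cs
  proof (rule strict_sorted_equal)
    have "distinct cs" using cs by (simp add: strict_lists_def strict_sorted_iff)
    then have "card (set cs) = card {..<N}" using cs by (simp add: strict_lists_def distinct_card)
    then have "set cs = {..<N}" using cs by (intro card_subset_eq) (auto simp: strict_lists_def)
    then show "set cs = set [0..<N]" by (simp add: atLeast0LessThan)
  qed (use cs in \<open>simp_all add: strict_lists_def\<close>)
  moreover have "[0..<N] \<in> strict_lists N N" by (auto simp: strict_lists_def)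
  ultimately have "strict_lists N N = {[0..<N]}" by blast
  then show ?case by (simp add: T D U0_stat_def atLeast0LessThan)
next
  case (Suc n)
  let ?w = "\<lambda>cs es. sum_list es - sum_list (map (\<lambda>c. c - 1) cs)"
  let ?P = "\<lambda>cs es. 0 \<notin> set cs \<and> es \<in> interlacing (n + N) (map (\<lambda>c. c - 1) cs)"
  have sub: "es \<in> strict_lists (n + N) N"
    if "cs \<in> strict_lists (Suc n + N) N" "?P cs es" for cs es
  proof -
    have pos: "c - 1 < d - 1" if "c < d" "c \<in> set cs" for c d
      using that \<open>?P cs es\<close> by (cases c) auto
    have srt: "sorted_wrt (<) (map (\<lambda>c. c - 1) cs)"
      using that pos unfolding sorted_wrt_map strict_lists_def
      by (auto intro: sorted_wrt_mono_rel[of cs "(<)"])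
    have bnd: "set (map (\<lambda>c. c - 1) cs) \<subseteq> {..<n + N}"
    proof
      fix x assume "x \<in> set (map (\<lambda>c. c - 1) cs)"
      then obtain c where "c \<in> set cs" "x = c - 1" by auto
      moreover from this have "c \<noteq> 0" using that(2) by metis
      moreover have "c < Suc n + N" using \<open>c \<in> set cs\<close> that(1) by (auto simp: strict_lists_def)
      ultimately show "x \<in> {..<n + N}" by auto
    qed
    have "length es = N"
      using that by (auto simp: in_interlacing_iff strict_lists_def)
    then show ?thesis
      using interlacing_bounds(1,2)[OF conjunct2[OF that(2)] srt bnd] by (simp add: strict_lists_def)
  qed
  \<comment> \<open>Moving the interlacing condition into the summand leaves two fixed ranges, so
    the sums can be exchanged.\<close>
  have "(\<Sum>cs\<in>strict_lists (Suc n + N) N. h cs * B_minor t (Suc n) ({..<Suc n + N} - set cs)) =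
      (\<Sum>cs\<in>strict_lists (Suc n + N) N. \<Sum>es\<in>strict_lists (n + N) N.
        if ?P cs es then h cs * (t ^ ?w cs es * B_minor 1 n ({..<n + N} - set es)) else 0)"
  proof (rule sum.cong[OF refl])
    fix cs assume cs: "cs \<in> strict_lists (Suc n + N) N"
    then have "B_minor t (Suc n) ({..<Suc (n + N)} - set cs) = (if 0 \<in> set cs then 0 else
      \<Sum>es\<in>interlacing (n + N) (map (\<lambda>c. c - 1) cs). t ^ ?w cs es * B_minor 1 n ({..<n + N} - set es))"
      by (intro B_minor_Suc) (auto simp: strict_lists_def)
    moreover have "(\<Sum>es\<in>strict_lists (n + N) N.
        if ?P cs es then h cs * (t ^ ?w cs es * B_minor 1 n ({..<n + N} - set es)) else 0) =
      (\<Sum>es\<in>{es \<in> strict_lists (n + N) N. ?P cs es}. h cs * (t ^ ?w cs es * B_minor 1 n ({..<n + N} - set es)))"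
      by (rule sum.inter_filter[OF finite_strict_lists, symmetric])
    moreover have "{es \<in> strict_lists (n + N) N. ?P cs es} =
        (if 0 \<in> set cs then {} else interlacing (n + N) (map (\<lambda>c. c - 1) cs))"
      using sub[OF cs] by auto
    ultimately show "h cs * B_minor t (Suc n) ({..<Suc n + N} - set cs) =
        (\<Sum>es\<in>strict_lists (n + N) N.
          if ?P cs es then h cs * (t ^ ?w cs es * B_minor 1 n ({..<n + N} - set es)) else 0)"
      by (simp add: sum_distrib_left del: upt_Suc)
  qed
  also have "\<dots> = (\<Sum>es\<in>strict_lists (n + N) N. \<Sum>cs\<in>strict_lists (Suc n + N) N.
        if ?P cs es then h cs * (t ^ ?w cs es * B_minor 1 n ({..<n + N} - set es)) else 0)"
    by (rule sum.swap)
  also have "\<dots> = (\<Sum>es\<in>strict_lists (n + N) N.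
      (\<Sum>cs\<in>above N es. h cs * t ^ ?w cs es) * B_minor 1 n ({..<n + N} - set es))"
  proof (rule sum.cong[OF refl])
    fix es assume es: "es \<in> strict_lists (n + N) N"
    have "{cs \<in> strict_lists (Suc n + N) N. ?P cs es} = above N es"
      using above_iff[OF es] by auto
    then show "(\<Sum>cs\<in>strict_lists (Suc n + N) N.
        if ?P cs es then h cs * (t ^ ?w cs es * B_minor 1 n ({..<n + N} - set es)) else 0) =
      (\<Sum>cs\<in>above N es. h cs * t ^ ?w cs es) * B_minor 1 n ({..<n + N} - set es)"
      by (simp only: sum.inter_filter[OF finite_strict_lists, symmetric] sum_distrib_right mult.assoc)
  qed
  \<comment> \<open>At \<open>t = 1\<close> the inner array carries no weight of its own; the new
    \<open>h\<close> is the weighted sum over the diagonals that fit it.\<close>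
  also have "\<dots> = (\<Sum>b\<in>tri_arrays n. 1 ^ nat (U0_stat n b) *
      (\<Sum>cs\<in>above N (diag_list n N b). h cs * t ^ ?w cs (diag_list n N b)))"
    using Suc.prems by (intro Suc.IH) simp
  also have "\<dots> = (\<Sum>b\<in>tri_arrays (Suc n). h (diag_list (Suc n) N b) *
      t ^ ?w (diag_list (Suc n) N b) (diag_list n N (inner_array n b)))"
    using Suc.prems
      sum_tri_arrays_Suc[of n N "\<lambda>b cs. h cs * t ^ ?w cs (diag_list n N b)"] by simp
  also have "\<dots> = (\<Sum>b\<in>tri_arrays (Suc n). t ^ nat (U0_stat (Suc n) b) * h (diag_list (Suc n) N b))"
  proof (rule sum.cong[OF refl])
    fix b assume b: "b \<in> tri_arrays (Suc n)"
    have "?w (diag_list (Suc n) N b) (diag_list n N (inner_array n b)) = nat (U0_stat (Suc n) b)"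
      using sum_list_diag_list_diff[OF _ b, of N] Suc.prems by simp
    then show "h (diag_list (Suc n) N b) * t ^ ?w (diag_list (Suc n) N b) (diag_list n N (inner_array n b)) =
        t ^ nat (U0_stat (Suc n) b) * h (diag_list (Suc n) N b)" by (simp only: mult.commute)
  qed
  finally show ?case .
qed

section \<open>The block Pfaffian\<close>

text \<open>Both sides run over subsets of size \<open>l + 1\<close> with a marked element.\<close>

lemma sum_subsets_pick:
  assumes "finite (U :: 'b set)"
  shows "(\<Sum>u\<in>U. \<Sum>J | J \<subseteq> U - {u} \<and> card J = l. f u J) =
    (\<Sum>J | J \<subseteq> U \<and> card J = Suc l. \<Sum>j\<in>J. f j (J - {j}) :: 'a::comm_monoid_add)"
proof -
  have fin: "finite {J. J \<subseteq> V \<and> P J}" if "V \<subseteq> U" for V P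
    by (rule finite_subset[of _ "Pow U"]) (use that assms in auto)
  have finJ: "finite J" if "J \<subseteq> U" for J using that assms by (rule finite_subset)
  have "(\<Sum>u\<in>U. \<Sum>J | J \<subseteq> U - {u} \<and> card J = l. f u J) =
      (\<Sum>(u, J)\<in>(SIGMA u:U. {J. J \<subseteq> U - {u} \<and> card J = l}). f u J)"
    using assms fin by (intro sum.Sigma) auto
  also have "\<dots> = (\<Sum>(J, j)\<in>(SIGMA J:{J. J \<subseteq> U \<and> card J = Suc l}. J). f j (J - {j}))"
  proof (rule sum.reindex_bij_witness[where i = "\<lambda>(J, j). (j, J - {j})" and j = "\<lambda>(u, J). (insert u J, u)"])
    fix p assume p: "p \<in> (SIGMA u:U. {J. J \<subseteq> U - {u} \<and> card J = l})"
    then obtain u J where "p = (u, J)" "u \<in> U" "J \<subseteq> U - {u}" "card J = l" by auto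
    moreover from this have "u \<notin> J" "finite J" using finJ[of J] by auto
    ultimately show "(case (case p of (u, J) \<Rightarrow> (insert u J, u)) of (J, j) \<Rightarrow> (j, J - {j})) = p"
      "(case p of (u, J) \<Rightarrow> (insert u J, u)) \<in> (SIGMA J:{J. J \<subseteq> U \<and> card J = Suc l}. J)"
      "(case case p of (u, J) \<Rightarrow> (insert u J, u) of (J, j) \<Rightarrow> f j (J - {j})) = (case p of (u, J) \<Rightarrow> f u J)"
      by auto
  next
    fix p assume p: "p \<in> (SIGMA J:{J. J \<subseteq> U \<and> card J = Suc l}. J)"
    then obtain J j where *: "p = (J, j)" "J \<subseteq> U" "card J = Suc l" "j \<in> J" by auto
    have "card (J - {j}) = l" using * finJ[of J] by simp
    with * show "(case case p of (J, j) \<Rightarrow> (j, J - {j}) of (u, J) \<Rightarrow> (insert u J, u)) = p"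
      "(case p of (J, j) \<Rightarrow> (j, J - {j})) \<in> (SIGMA u:U. {J. J \<subseteq> U - {u} \<and> card J = l})"
      by auto
  qed
  also have "\<dots> = (\<Sum>J | J \<subseteq> U \<and> card J = Suc l. \<Sum>j\<in>J. f j (J - {j}))"
    using fin finJ by (intro sum.Sigma[symmetric]) auto
  finally show ?thesis .
qed

lemma pf_set_block:
  fixes a :: "nat \<Rightarrow> nat \<Rightarrow> 'a::comm_ring_1"
  assumes zero: "\<And>x y. x < y \<Longrightarrow> y < n \<Longrightarrow> a x y = 0"
    and rows: "\<And>x u. x < n \<Longrightarrow> u < L \<Longrightarrow> a x (n + u) = F (n - 1 - x) u"
    and "l \<le> n" "U \<subseteq> {..<L}" "even (l + card U)"
  shows "pf_set a ({n - l..<n} \<union> (+) n ` U) = (\<Sum>J | J \<subseteq> U \<and> card J = l.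
    (- 1) ^ (\<Sum>j\<in>J. card {c \<in> U - J. c < j}) * minor (map F (rev [0..<l])) J * pf_set a ((+) n ` (U - J)))"
  using assms(3-)
proof (induction l arbitrary: U)
  case 0
  have "finite U" using 0 by (auto intro: finite_subset)
  then have "{J. J \<subseteq> U \<and> card J = 0} = {{}}" by (auto dest: finite_subset)
  then show ?case by simp
next
  case (Suc l)
  have finU: "finite U" using Suc.prems by (auto intro: finite_subset)
  let ?V = "{n - l..<n} \<union> (+) n ` U" and ?x = "n - Suc l"
  have disj: "{n - l..<n} \<inter> (+) n ` U = {}" by auto
  have cardV: "card ?V = l + card U"
    using finU disj Suc.prems by (subst card_Un_disjoint) (auto simp: card_image)
  have "{n - Suc l..<n} = insert ?x {n - l..<n}" using Suc.prems by auto
  then have "pf_set a ({n - Suc l..<n} \<union> (+) n ` U) = pf_set a (insert ?x ?V)" by simp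
  also have "\<dots> = (\<Sum>v\<in>?V. (- 1) ^ card {w \<in> ?V. w < v} * a ?x v * pf_set a (?V - {v}))"
    using finU cardV Suc.prems by (intro pf_set_expand) auto
  also have "\<dots> = (\<Sum>v\<in>(+) n ` U. (- 1) ^ card {w \<in> ?V. w < v} * a ?x v * pf_set a (?V - {v}))"
    using finU Suc.prems by (intro sum.mono_neutral_right) (auto simp: zero)
  also have "\<dots> = (\<Sum>u\<in>U. (- 1) ^ (l + card {v \<in> U. v < u}) * F l u * pf_set a ({n - l..<n} \<union> (+) n ` (U - {u})))"
  proof (subst sum.reindex, simp, unfold o_def, rule sum.cong[OF refl])
    fix u assume u: "u \<in> U"
    \<comment> \<open>The \<open>l\<close> remaining rows precede every column, so they count in the
      sign although their own entries vanish.\<close>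
    have "{w \<in> ?V. w < n + u} = {n - l..<n} \<union> (+) n ` {v \<in> U. v < u}" by auto
    also have "card \<dots> = l + card {v \<in> U. v < u}"
      using finU Suc.prems by (subst card_Un_disjoint) (auto simp: card_image)
    finally have "card {w \<in> ?V. w < n + u} = l + card {v \<in> U. v < u}" .
    moreover have "?V - {n + u} = {n - l..<n} \<union> (+) n ` (U - {u})" by auto
    moreover have "a ?x (n + u) = F l u"
      using rows[of ?x u] u Suc.prems by auto
    ultimately show "(- 1) ^ card {w \<in> ?V. w < n + u} * a ?x (n + u) * pf_set a (?V - {n + u}) =
        (- 1) ^ (l + card {v \<in> U. v < u}) * F l u * pf_set a ({n - l..<n} \<union> (+) n ` (U - {u}))"
      by simp
  qed
  also have "\<dots> = (\<Sum>u\<in>U. \<Sum>J | J \<subseteq> U - {u} \<and> card J = l. (- 1) ^ (l + card {v \<in> U. v < u}) * F l u *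
      ((- 1) ^ (\<Sum>j\<in>J. card {c \<in> U - insert u J. c < j}) * minor (map F (rev [0..<l])) J *
        pf_set a ((+) n ` (U - insert u J))))"
  proof (rule sum.cong[OF refl])
    fix u assume u: "u \<in> U"
    have "even (l + card (U - {u}))"
      using Suc.prems card.remove[OF finU u] by (auto simp del: card_Diff_insert)
    then have "pf_set a ({n - l..<n} \<union> (+) n ` (U - {u})) = (\<Sum>J | J \<subseteq> U - {u} \<and> card J = l.
        (- 1) ^ (\<Sum>j\<in>J. card {c \<in> U - {u} - J. c < j}) * minor (map F (rev [0..<l])) J *
        pf_set a ((+) n ` (U - {u} - J)))"
      using Suc.prems by (intro Suc.IH) auto
    moreover have "U - {u} - J = U - insert u J" for J by auto
    ultimately show "(- 1) ^ (l + card {v \<in> U. v < u}) * F l u * pf_set a ({n - l..<n} \<union> (+) n ` (U - {u})) =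
      (\<Sum>J | J \<subseteq> U - {u} \<and> card J = l. (- 1) ^ (l + card {v \<in> U. v < u}) * F l u *
      ((- 1) ^ (\<Sum>j\<in>J. card {c \<in> U - insert u J. c < j}) * minor (map F (rev [0..<l])) J *
        pf_set a ((+) n ` (U - insert u J))))"
      by (simp only: sum_distrib_left)
  qed
  also have "\<dots> = (\<Sum>J | J \<subseteq> U \<and> card J = Suc l. \<Sum>u\<in>J. (- 1) ^ (l + card {v \<in> U. v < u}) * F l u *
      ((- 1) ^ (\<Sum>j\<in>J - {u}. card {c \<in> U - insert u (J - {u}). c < j}) * minor (map F (rev [0..<l])) (J - {u}) *
        pf_set a ((+) n ` (U - insert u (J - {u})))))"
    by (rule sum_subsets_pick[OF finU])
  also have "\<dots> = (\<Sum>J | J \<subseteq> U \<and> card J = Suc l.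
    (- 1) ^ (\<Sum>j\<in>J. card {c \<in> U - J. c < j}) * minor (map F (rev [0..<Suc l])) J * pf_set a ((+) n ` (U - J)))"
  proof (rule sum.cong[OF refl])
    fix J assume J: "J \<in> {J. J \<subseteq> U \<and> card J = Suc l}"
    then have finJ: "finite J" using finU by (auto intro: finite_subset)
    let ?s = "\<lambda>J'. \<Sum>j\<in>J'. card {c \<in> U - J. c < j}"
    have rev: "map F (rev [0..<Suc l]) = F l # map F (rev [0..<l])" by simp
    have "(- 1) ^ (l + card {v \<in> U. v < u}) * ((- 1) ^ ?s (J - {u})) =
        (- 1) ^ ?s J * ((- 1) ^ card {i \<in> J. u < i} :: 'a)" if u: "u \<in> J" for u
    proof -
      let ?a = "card {v \<in> J. v < u}" and ?b = "card {i \<in> J. u < i}" and ?c = "card {c \<in> U - J. c < u}"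
      have "{v \<in> U. v < u} = {v \<in> J. v < u} \<union> {c \<in> U - J. c < u}" using J by auto
      also have "card \<dots> = ?a + ?c"
        using finJ finU by (intro card_Un_disjoint) auto
      finally have 1: "card {v \<in> U. v < u} = ?a + ?c" .
      have "J - {u} = {v \<in> J. v < u} \<union> {i \<in> J. u < i}" by auto
      also have "card \<dots> = ?a + ?b" using finJ by (intro card_Un_disjoint) auto
      finally have 2: "l = ?a + ?b" using J u finJ by simp
      have 3: "?s J = ?c + ?s (J - {u})" by (rule sum.remove[OF finJ u])
      have "l + card {v \<in> U. v < u} + ?s (J - {u}) = 2 * ?a + (?s J + ?b)"
        using 1 2 3 by linarith
      then have "(- 1) ^ (l + card {v \<in> U. v < u} + ?s (J - {u})) = ((- 1) ^ (?s J + ?b) :: 'a)"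
        by (simp only: power_add power_mult) simp
      then show ?thesis by (simp only: power_add)
    qed
    note sign = this
    have "(\<Sum>u\<in>J. (- 1) ^ (l + card {v \<in> U. v < u}) * F l u *
      ((- 1) ^ (\<Sum>j\<in>J - {u}. card {c \<in> U - insert u (J - {u}). c < j}) * minor (map F (rev [0..<l])) (J - {u}) *
        pf_set a ((+) n ` (U - insert u (J - {u}))))) =
      (\<Sum>u\<in>J. (- 1) ^ ?s J * ((- 1) ^ card {i \<in> J. u < i} * F l u * minor (map F (rev [0..<l])) (J - {u})) *
        pf_set a ((+) n ` (U - J)))"
    proof (rule sum.cong[OF refl])
      fix u assume u: "u \<in> J"
      then have ins: "insert u (J - {u}) = J" by auto
      have "(- 1) ^ (l + card {v \<in> U. v < u}) * F l u *
        ((- 1) ^ ?s (J - {u}) * minor (map F (rev [0..<l])) (J - {u}) * pf_set a ((+) n ` (U - J))) =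
        ((- 1) ^ (l + card {v \<in> U. v < u}) * (- 1) ^ ?s (J - {u})) *
          (F l u * minor (map F (rev [0..<l])) (J - {u}) * pf_set a ((+) n ` (U - J)))"
        by (simp only: mult_ac)
      then show "(- 1) ^ (l + card {v \<in> U. v < u}) * F l u *
      ((- 1) ^ (\<Sum>j\<in>J - {u}. card {c \<in> U - insert u (J - {u}). c < j}) * minor (map F (rev [0..<l])) (J - {u}) *
        pf_set a ((+) n ` (U - insert u (J - {u})))) =
        (- 1) ^ ?s J * ((- 1) ^ card {i \<in> J. u < i} * F l u * minor (map F (rev [0..<l])) (J - {u})) *
        pf_set a ((+) n ` (U - J))"
        unfolding ins sign[OF u] by (simp only: mult_ac)
    qed
    then show "(\<Sum>u\<in>J. (- 1) ^ (l + card {v \<in> U. v < u}) * F l u *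
      ((- 1) ^ (\<Sum>j\<in>J - {u}. card {c \<in> U - insert u (J - {u}). c < j}) * minor (map F (rev [0..<l])) (J - {u}) *
        pf_set a ((+) n ` (U - insert u (J - {u}))))) =
      (- 1) ^ (\<Sum>j\<in>J. card {c \<in> U - J. c < j}) * minor (map F (rev [0..<Suc l])) J * pf_set a ((+) n ` (U - J))"
      unfolding rev minor.simps by (simp only: sum_distrib_left sum_distrib_right)
  qed
  finally show ?case .
qed

section \<open>Cancellation of signs\<close>

lemma sum_card_greater:
  assumes "finite (C :: nat set)"
  shows "2 * (\<Sum>c\<in>C. card {d \<in> C. c < d}) + card C = card C * card C"
  using assms
proof (induction C rule: finite_linorder_max_induct)
  case (insert m C)
  have m: "m \<notin> C" using insert.hyps by auto
  have 0: "{d \<in> insert m C. m < d} = {}" using insert.hyps by auto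
  have 1: "card {d \<in> insert m C. c < d} = Suc (card {d \<in> C. c < d})" if "c \<in> C" for c
  proof -
    have "{d \<in> insert m C. c < d} = insert m {d \<in> C. c < d}" using that insert.hyps by auto
    then show ?thesis using insert.hyps m by simp
  qed
  have "(\<Sum>c\<in>insert m C. card {d \<in> insert m C. c < d}) =
      card {d \<in> insert m C. m < d} + (\<Sum>c\<in>C. card {d \<in> insert m C. c < d})"
    using insert.hyps(1) m by (rule sum.insert)
  also have "\<dots> = (\<Sum>c\<in>C. Suc (card {d \<in> C. c < d}))"
    unfolding 0 by (simp only: card.empty add_0) (intro sum.cong refl 1)
  also have "\<dots> = (\<Sum>c\<in>C. card {d \<in> C. c < d}) + card C"
    by (simp only: sum_Suc)
  finally have "(\<Sum>c\<in>insert m C. card {d \<in> insert m C. c < d}) = \<dots>" .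
  then show ?case using insert.IH insert.hyps m by (simp add: algebra_simps)
qed simp

text \<open>
  The sign of the Laplace expansion and the sign of the Pfaffian of \<open>S_bar\<close> on the unused columns
  cancel.
\<close>

lemma even_inversions:
  assumes "C \<subseteq> {..<L}" "even (card C)"
  shows "even ((\<Sum>j\<in>{..<L} - C. card {c \<in> C. c < j}) + (\<Sum>C + card C div 2))"
proof -
  have finC: "finite C" using assms(1) by (auto intro: finite_subset)
  obtain h where h: "card C = 2 * h" using assms(2) by blast
  let ?J = "{..<L} - C"
  have "(\<Sum>j\<in>?J. card {c \<in> C. c < j}) = (\<Sum>j\<in>?J. \<Sum>c\<in>C. if c < j then 1 else 0)"
    using finC by (simp add: sum.inter_filter[symmetric])
  also have "\<dots> = (\<Sum>c\<in>C. \<Sum>j\<in>?J. if c < j then 1 else 0)" by (rule sum.swap)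
  also have "\<dots> = (\<Sum>c\<in>C. card {j \<in> ?J. c < j})"
    by (simp add: sum.inter_filter[symmetric])
  finally have S: "(\<Sum>j\<in>?J. card {c \<in> C. c < j}) = (\<Sum>c\<in>C. card {j \<in> ?J. c < j})" .
  have "card {j \<in> ?J. c < j} + card {d \<in> C. c < d} + c + 1 = L" if c: "c \<in> C" for c
  proof -
    have "card {j \<in> ?J. c < j} + card {d \<in> C. c < d} = card ({j \<in> ?J. c < j} \<union> {d \<in> C. c < d})"
      using finC by (intro card_Un_disjoint[symmetric]) auto
    also have "{j \<in> ?J. c < j} \<union> {d \<in> C. c < d} = {c<..<L}" using assms(1) by auto
    finally show ?thesis using c assms(1) by auto
  qed
  then have "(\<Sum>c\<in>C. card {j \<in> ?J. c < j} + card {d \<in> C. c < d} + c + 1) = (\<Sum>c\<in>C. L)"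
    by (rule sum.cong[OF refl])
  then have "(\<Sum>c\<in>C. card {j \<in> ?J. c < j}) + (\<Sum>c\<in>C. card {d \<in> C. c < d}) + \<Sum>C + 2 * h = 2 * h * L"
    by (simp only: sum.distrib sum_constant h of_nat_id mult_1_right)
  moreover have "(\<Sum>c\<in>C. card {d \<in> C. c < d}) + h = 2 * (h * h)"
    using sum_card_greater[OF finC] by (simp add: h)
  ultimately have "(\<Sum>j\<in>?J. card {c \<in> C. c < j}) + (\<Sum>C + h) + 2 * (h * h) = 2 * (h * L)"
    unfolding S by linarith
  then have "even ((\<Sum>j\<in>?J. card {c \<in> C. c < j}) + (\<Sum>C + h) + 2 * (h * h))" by simp
  then show ?thesis by (simp add: h)
qed

lemma pf_set_eq_sum_minors:
  fixes a :: "nat \<Rightarrow> nat \<Rightarrow> 'a::comm_ring_1"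
  assumes "even N"
    and zero: "\<And>x y. x < y \<Longrightarrow> y < n \<Longrightarrow> a x y = 0"
    and rows: "\<And>x u. x < n \<Longrightarrow> u < n + N \<Longrightarrow> a x (n + u) = F (n - 1 - x) u"
    and alt: "\<And>u v. u < v \<Longrightarrow> v < n + N \<Longrightarrow> a (n + u) (n + v) = - ((- 1) ^ (u + v))"
  shows "pf_set a {..<n + (n + N)} =
    (\<Sum>cs\<in>strict_lists (n + N) N. minor (map F (rev [0..<n])) ({..<n + N} - set cs))"
proof -
  let ?U = "{..<n + N}"
  have U: "{..<n + (n + N)} = {n - n..<n} \<union> (+) n ` ?U"
  proof (intro equalityI subsetI)
    fix x assume "x \<in> {..<n + (n + N)}"
    then show "x \<in> {n - n..<n} \<union> (+) n ` ?U"
      by (cases "x < n") (auto intro!: image_eqI[where x = "x - n"])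
  qed auto
  have "pf_set a {..<n + (n + N)} = (\<Sum>J | J \<subseteq> ?U \<and> card J = n.
    (- 1) ^ (\<Sum>j\<in>J. card {c \<in> ?U - J. c < j}) * minor (map F (rev [0..<n])) J * pf_set a ((+) n ` (?U - J)))"
    unfolding U using assms(1) by (intro pf_set_block[where L = "n + N"] zero rows) auto
  also have "\<dots> = (\<Sum>J | J \<subseteq> ?U \<and> card J = n. minor (map F (rev [0..<n])) J)"
  proof (rule sum.cong[OF refl])
    fix J assume J: "J \<in> {J. J \<subseteq> ?U \<and> card J = n}"
    define C where "C = ?U - J"
    have C: "C \<subseteq> ?U" "finite C" "card C = N" and JC: "J = ?U - C"
      using J finite_subset[of J ?U] by (auto simp: C_def card_Diff_subset)
    have "pf_set a ((+) n ` C) = (- 1) ^ (\<Sum>((+) n ` C) + card ((+) n ` C) div 2)"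
    proof (rule pf_set_alternating)
      fix i j assume "i < j" "i \<in> (+) n ` C" "j \<in> (+) n ` C"
      then obtain u v where "i = n + u" "j = n + v" "u < v" "v < n + N" using C(1) by auto
      then show "a i j = - ((- 1) ^ (i + j))"
        using alt[of u v] by (simp add: power_add mult_ac)
    qed (use C assms(1) in \<open>simp_all add: card_image\<close>)
    \<comment> \<open>The shift by \<open>n\<close> contributes \<open>n * N\<close>, which is even
      and does not affect the sign.\<close>
    also have "\<Sum>((+) n ` C) = n * N + \<Sum>C"
      by (simp add: sum.reindex sum.distrib C(3))
    also have "(- 1) ^ (n * N + \<Sum>C + card ((+) n ` C) div 2) = ((- 1) ^ (\<Sum>C + card C div 2) :: 'a)"
      using assms(1) by (simp add: card_image power_add)
    finally have "(- 1) ^ (\<Sum>j\<in>J. card {c \<in> C. c < j}) * pf_set a ((+) n ` C) =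
        (- 1) ^ ((\<Sum>j\<in>?U - C. card {c \<in> C. c < j}) + (\<Sum>C + card C div 2))"
      by (simp only: JC power_add)
    also have "\<dots> = 1"
      using even_inversions[OF C(1)] C(3) assms(1) by simp
    finally have "(- 1) ^ (\<Sum>j\<in>J. card {c \<in> C. c < j}) * pf_set a ((+) n ` C) = 1" .
    note sign = this[unfolded C_def]
    have "(- 1) ^ (\<Sum>j\<in>J. card {c \<in> ?U - J. c < j}) * minor (map F (rev [0..<n])) J * pf_set a ((+) n ` (?U - J)) =
        ((- 1) ^ (\<Sum>j\<in>J. card {c \<in> ?U - J. c < j}) * pf_set a ((+) n ` (?U - J))) * minor (map F (rev [0..<n])) J"
      by (simp only: mult_ac)
    then show "(- 1) ^ (\<Sum>j\<in>J. card {c \<in> ?U - J. c < j}) * minor (map F (rev [0..<n])) J *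
        pf_set a ((+) n ` (?U - J)) = minor (map F (rev [0..<n])) J"
      unfolding sign mult_1 .
  qed
  also have "\<dots> = (\<Sum>cs\<in>strict_lists (n + N) N. minor (map F (rev [0..<n])) (?U - set cs))"
  proof (rule sum.reindex_bij_witness[where i = "\<lambda>cs. ?U - set cs" and j = "\<lambda>J. sorted_list_of_set (?U - J)"])
    fix J assume J: "J \<in> {J. J \<subseteq> ?U \<and> card J = n}"
    have "card (?U - J) = N" using J finite_subset[of J ?U] by (auto simp: card_Diff_subset)
    then show "sorted_list_of_set (?U - J) \<in> strict_lists (n + N) N"
      by (auto simp: strict_lists_def)
    show "?U - set (sorted_list_of_set (?U - J)) = J" using J by auto
    then show "minor (map F (rev [0..<n])) (?U - set (sorted_list_of_set (?U - J))) =
      minor (map F (rev [0..<n])) J" by simp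
  next
    fix cs assume cs: "cs \<in> strict_lists (n + N) N"
    then have sub: "set cs \<subseteq> ?U" and "card (set cs) = N"
      by (auto simp: strict_lists_def strict_sorted_iff distinct_card)
    then show "?U - set cs \<in> {J. J \<subseteq> ?U \<and> card J = n}"
      by (auto simp: card_Diff_subset)
    have "?U - (?U - set cs) = set cs" using sub by auto
    then show "sorted_list_of_set (?U - (?U - set cs)) = cs"
      using cs by (simp add: strict_lists_def strict_sorted_iff sorted_list_of_set.idem_if_sorted_distinct)
  qed
  finally show ?thesis .
qed

lemma J_mat_times:
  assumes "A \<in> carrier_mat n m" "i < n" "j < m"
  shows "(J_mat n * A) $$ (i, j) = A $$ (n - 1 - i, j)"
proof -
  have "(J_mat n * A) $$ (i, j) = (\<Sum>k\<in>{0..<n}. of_bool (i + k + 1 = n) * A $$ (k, j))"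
    using assms by (simp add: J_mat_def scalar_prod_def)
  also have "\<dots> = (\<Sum>k\<in>{n - 1 - i}. A $$ (k, j))"
    using assms by (intro sum.mono_neutral_cong_right) auto
  finally show ?thesis by simp
qed

theorem theorem1p2:
  fixes n N r :: nat and t :: "'a::comm_ring_1"
  assumes "n \<ge> 1" and "even N" and "N \<ge> n - 1" and "1 \<le> r" and "r \<le> n"
  shows "(\<Sum>b \<in> tri_arrays n. t ^ nat (U_stat n r b)) =
    pfaffian (four_block_mat
      (0\<^sub>m n n)                                 (J_mat n * B_mat n N t)
      (- (transpose_mat (B_mat n N t)) * J_mat n)   (S_bar (n + N)))"
proof -
  let ?M = "four_block_mat (0\<^sub>m n n) (J_mat n * B_mat n N t)
      (- (transpose_mat (B_mat n N t)) * J_mat n) (S_bar (n + N))"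
  let ?a = "\<lambda>i j. ?M $$ (i, j)"
  have B: "B_mat n N t \<in> carrier_mat n (n + N)" by (simp add: B_mat_def)
  have dims: "dim_row ?M = n + (n + N)" "dim_col ?M = n + (n + N)"
    by (simp_all add: S_bar_def)
  have even: "2 * (dim_row ?M div 2) = n + (n + N)"
    unfolding dims using assms(2) by (intro dvd_mult_div_cancel) simp
  have "pfaffian ?M = pf_set ?a {..<n + (n + N)}"
    unfolding pfaffian_eq_matching_sum pf_set_lessThan[symmetric] even ..
  also have "\<dots> = (\<Sum>cs\<in>strict_lists (n + N) N. B_minor t n ({..<n + N} - set cs))"
  proof (rule pf_set_eq_sum_minors[OF assms(2)])
    show "?a x y = 0" if "x < y" "y < n" for x y
      using that by (simp add: J_mat_def B_mat_def S_bar_def)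
    show "?a x (n + u) = B_row t (n - 1 - x) u" if "x < n" "u < n + N" for x u
    proof -
      have "?a x (n + u) = (J_mat n * B_mat n N t) $$ (x, u)"
        using that by (simp add: S_bar_def)
      also have "\<dots> = B_mat n N t $$ (n - 1 - x, u)"
        by (rule J_mat_times[OF B that])
      also have "\<dots> = B_row t (n - 1 - x) u"
        using that by (simp add: B_mat_def B_row_def)
      finally show ?thesis .
    qed
    show "?a (n + u) (n + v) = - ((- 1) ^ (u + v))" if uv: "u < v" "v < n + N" for u v
    proof -
      obtain k where k: "v = Suc (u + k)" using less_imp_Suc_add[OF uv(1)] by blast
      have "?a (n + u) (n + v) = (- 1) ^ (v - u - 1)"
        using uv by (simp add: S_bar_def)
      \<comment> \<open>The exponents \<open>v - u - 1\<close> and \<open>u + v + 1\<close> have the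
        same parity.\<close>
      also have "\<dots> = - ((- 1) ^ (u + v))"
        by (simp add: k power_add)
      finally show ?thesis .
    qed
  qed
  also have "\<dots> = (\<Sum>b\<in>tri_arrays n. t ^ nat (U0_stat n b))"
    using sum_B_minor[of n N "\<lambda>_. 1" t] assms(3) by simp
  also have "\<dots> = (\<Sum>b\<in>tri_arrays n. t ^ nat (U_stat n r b))"
    using sum_U_stat[OF assms(4,5), of "\<lambda>u. t ^ nat u"] by simp
  finally show ?thesis by simp
qed

end
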